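(* Let $H$ be a compound graph, whose base edges carry weights in an integral domain $R$, let $p$ be a leaf of $H$, and let $H_1,H_2,\ldots,H_k$ be all the members of the family of $H$ with respect to $p$. For each $i$ let $\overline{H}_i$ be a sign-weighted version of $H_i$, obtained from a sign function in $S(H_i)$. Then for some choice of signs, $$\#\overline{H}_1 \pm \#\overline{H}_2 \pm \cdots \pm \#\overline{H}_k = 0 .$$
   Context: All graphs are finite. For a graph $X$ with edge weights in an integral domain $R$, the weight of a perfect matching is the product of the weights of its edges, and $\#X$ denotes the sum of the weights of all perfect matchings of $X$. Compound graphs. Choose two planar bipartite graphs, the base graph $G$ (with a fixed planar embedding) and the supergraph, each with a black/white bipartite coloring; $G$ must have equally many black and white vertices. A compound graph $H$ is obtained as follows. (1) Place a copy of $G$ (with its coloring) at each vertex of the supergraph; copies at black vertices of the supergraph keep the original embedding of $G$, copies at white vertices get the reflected embedding. The copies are placed outside of each other, so that all inner faces of each copy are preserved. The vertices and edges of the copies are called base vertices and base edges. Two base vertices (respectively base edges) are equivalent, written $\cong$, if they correspond to the same vertex (respectively edge) of $G$. The "outer face" of a copy means the original outer face of $G$. (2) For each edge of the supergraph, with endpoints corresponding to copies $G_1,G_2$, one may add one or more new vertices called stems. Each stem is joined to exactly one vertex on the outer face of $G_1$ and exactly one vertex on the outer face of $G_2$, and these two vertices must be equivalent. All stems are colored black, so they are joined to white base vertices. (3) If $r$ stems were added in total, add $r$ new vertices called leaves, each of degree 1 and joined to a black base vertex on the outer face of some copy of $G$. All leaves are colored white. The resulting graph must be planar, and is drawn in the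 plane with the stems and leaves outside of all copies of the base graph, so that the inner faces of the copies are preserved; otherwise any planar embedding of the stems and leaves may be chosen. Weights. $G$ has edge weights in $R$; each base edge of $H$ has the weight of the corresponding edge of $G$; each edge incident to a stem or a leaf has weight $1$. Sign functions. For a bipartite graph embedded in the plane with edge set $E$, a sign function is a function $\operatorname{sgn}\colon E\to\{1,-1\}$ such that for every simple cycle $\mathcal C$ of length $2\ell$ that strictly encloses an even number of vertices, $\prod_{e\in\mathcal C}\operatorname{sgn} e=(-1)^{\ell-1}$. For a compound graph $H$, $S(H)$ denotes the set of sign functions on $H$ that respect the equivalence relation, i.e. $\operatorname{sgn} e_1=\operatorname{sgn} e_2$ whenever $e_1\cong e_2$ are equivalent base edges. Sign-weighting. Given $\operatorname{sgn}\in S(H)$, the sign-weighted compound graph $\overline{H}$ is the graph $H$ in which the weight of each edge $e$ incident to a stem or a leaf is multiplied by $\operatorname{sgn} e$ (weights of base edges are unchanged). Families. Let $H$ be a compound graph and $p$ a leaf of $H$, attached to the base vertex $q$. A sibling of $H$ is a compound graph formed by deleting $p$ and adding a new leaf $p'$ attached to another base vertex $q'\neq q$ with $q'\cong q$; everything else is unchanged. The family of $H$ with respect to $p$ consists of $H$ together with its siblings, one for each such $q'$ (so its number $k$ of members is the number of vertices of the supergraph). *)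

theory Defs
  imports "HOL-Analysis.Analysis"
begin

section \<open>Bipartite graphs, perfect matchings\<close>

text \<open>A simple graph with a fixed black/white colouring.  Each edge is stored as the ordered pair
  (black endpoint, white endpoint).\<close>

record 'v bgraph =
  blacks :: "'v set"
  whites :: "'v set"
  edges :: "('v \<times> 'v) set"

definition verts :: "'v bgraph \<Rightarrow> 'v set" where
  "verts G = blacks G \<union> whites G"

definition bipartite_graph :: "'v bgraph \<Rightarrow> bool" where
  "bipartite_graph G \<longleftrightarrow>
     finite (blacks G) \<and> finite (whites G) \<and> blacks G \<inter> whites G = {} \<and>
     edges G \<subseteq> blacks G \<times> whites G"

definition perfect_matching :: "'v bgraph \<Rightarrow> ('v \<times> 'v) set \<Rightarrow> bool" where
  "perfect_matching G M \<longleftrightarrow>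
     M \<subseteq> edges G \<and> (\<forall>v\<in>verts G. \<exists>!e. e \<in> M \<and> (v = fst e \<or> v = snd e))"

definition matching_sum :: "'v bgraph \<Rightarrow> ('v \<times> 'v \<Rightarrow> 'r::idom) \<Rightarrow> 'r" where
  "matching_sum G wt = (\<Sum>M\<in>{M. perfect_matching G M}. \<Prod>e\<in>M. wt e)"

section \<open>Plane drawings\<close>

record 'v drawing =
  point :: "'v \<Rightarrow> complex"
  curve :: "'v \<times> 'v \<Rightarrow> real \<Rightarrow> complex"

definition plane_drawing :: "'v bgraph \<Rightarrow> 'v drawing \<Rightarrow> bool" where
  "plane_drawing G D \<longleftrightarrow>
     inj_on (point D) (verts G) \<and>
     (\<forall>(b, w)\<in>edges G. arc (curve D (b, w)) \<and>
        pathstart (curve D (b, w)) = point D b \<and> pathfinish (curve D (b, w)) = point D w) \<and>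
     (\<forall>e\<in>edges G. \<forall>v\<in>verts G.
        point D v \<in> path_image (curve D e) \<longrightarrow> v = fst e \<or> v = snd e) \<and>
     (\<forall>e\<in>edges G. \<forall>f\<in>edges G. e \<noteq> f \<longrightarrow>
        path_image (curve D e) \<inter> path_image (curve D f) \<subseteq> point D ` verts G)"

definition planar :: "'v bgraph \<Rightarrow> bool" where
  "planar G \<longleftrightarrow> (\<exists>D. plane_drawing G D)"

definition drawn_set :: "'v bgraph \<Rightarrow> 'v drawing \<Rightarrow> complex set" where
  "drawn_set G D = point D ` verts G \<union> (\<Union>e\<in>edges G. path_image (curve D e))"

definition on_outer_face :: "'v bgraph \<Rightarrow> 'v drawing \<Rightarrow> 'v \<Rightarrow> bool" where
  "on_outer_face G D v \<longleftrightarrow> point D v \<in> frontier (outside (drawn_set G D))"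

section \<open>Sign functions\<close>

text \<open>The lists \<open>bs = [b\<^sub>0, \<dots>, b\<^sub>l\<^sub>-\<^sub>1]\<close> and \<open>ws = [w\<^sub>0, \<dots>, w\<^sub>l\<^sub>-\<^sub>1]\<close> represent the cycle
  \<open>b\<^sub>0 w\<^sub>0 b\<^sub>1 w\<^sub>1 \<dots> b\<^sub>l\<^sub>-\<^sub>1 w\<^sub>l\<^sub>-\<^sub>1 b\<^sub>0\<close> of length \<open>2 l\<close>.  A simple graph has no cycles of
  length 2, hence the condition \<open>l \<ge> 2\<close>.\<close>

definition cycle_edges :: "'v list \<Rightarrow> 'v list \<Rightarrow> ('v \<times> 'v) set" where
  "cycle_edges bs ws =
     (\<Union>i<length bs. {(bs ! i, ws ! i), (bs ! (Suc i mod length bs), ws ! i)})"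

definition simple_cycle :: "'v bgraph \<Rightarrow> 'v list \<Rightarrow> 'v list \<Rightarrow> bool" where
  "simple_cycle G bs ws \<longleftrightarrow>
     2 \<le> length bs \<and> length ws = length bs \<and> distinct bs \<and> distinct ws \<and>
     cycle_edges bs ws \<subseteq> edges G"

definition enclosed_verts :: "'v bgraph \<Rightarrow> 'v drawing \<Rightarrow> ('v \<times> 'v) set \<Rightarrow> 'v set" where
  "enclosed_verts G D C =
     {v \<in> verts G. point D v \<in> inside (\<Union>e\<in>C. path_image (curve D e))}"

definition sign_function :: "'v bgraph \<Rightarrow> 'v drawing \<Rightarrow> ('v \<times> 'v \<Rightarrow> int) \<Rightarrow> bool" where
  "sign_function G D \<sigma> \<longleftrightarrow>
     (\<forall>e\<in>edges G. \<sigma> e \<in> {1, -1}) \<and>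
     (\<forall>bs ws. simple_cycle G bs ws \<longrightarrow> even (card (enclosed_verts G D (cycle_edges bs ws))) \<longrightarrow>
        (\<Prod>e\<in>cycle_edges bs ws. \<sigma> e) = (-1) ^ (length bs - 1))"

section \<open>Compound graphs\<close>

datatype ('v, 's, 't, 'l) cvertex = Base 's 'v | Stem 't | Leaf 'l

text \<open>Base vertices are equivalent iff their \<open>'v\<close>-components agree.  A stem \<open>t\<close> belongs to the
  supergraph edge \<open>stem_edge H t\<close> and is joined to the vertex \<open>stem_at H t\<close> in both copies at the
  ends of that edge; a leaf \<open>l\<close> is joined to the vertex \<open>leaf_at H l\<close> of the copy
  \<open>leaf_copy H l\<close>.\<close>

record ('v, 's, 't, 'l) compound =
  base :: "'v bgraph"
  base_drawing :: "'v drawing"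
  super :: "'s bgraph"
  stems :: "'t set"
  stem_edge :: "'t \<Rightarrow> 's \<times> 's"
  stem_at :: "'t \<Rightarrow> 'v"
  leaves :: "'l set"
  leaf_copy :: "'l \<Rightarrow> 's"
  leaf_at :: "'l \<Rightarrow> 'v"
  total_drawing :: "('v, 's, 't, 'l) cvertex drawing"

definition total_graph :: "('v, 's, 't, 'l) compound \<Rightarrow> ('v, 's, 't, 'l) cvertex bgraph" where
  "total_graph H = \<lparr>
     blacks = {Base s v | s v. s \<in> verts (super H) \<and> v \<in> blacks (base H)} \<union> Stem ` stems H,
     whites = {Base s v | s v. s \<in> verts (super H) \<and> v \<in> whites (base H)} \<union> Leaf ` leaves H,
     edges =
       {(Base s b, Base s w) | s b w. s \<in> verts (super H) \<and> (b, w) \<in> edges (base H)} \<union>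
       {(Stem t, Base (fst (stem_edge H t)) (stem_at H t)) | t. t \<in> stems H} \<union>
       {(Stem t, Base (snd (stem_edge H t)) (stem_at H t)) | t. t \<in> stems H} \<union>
       {(Base (leaf_copy H l) (leaf_at H l), Leaf l) | l. l \<in> leaves H}\<rparr>"

definition isotopic_to_id :: "(complex \<Rightarrow> complex) \<Rightarrow> bool" where
  "isotopic_to_id \<phi> \<longleftrightarrow>
     (\<exists>h :: real \<times> complex \<Rightarrow> complex.
        continuous_on ({0..1} \<times> UNIV) h \<and>
        (\<forall>t\<in>{0..1}. \<exists>g. homeomorphism UNIV UNIV (\<lambda>z. h (t, z)) g) \<and>
        (\<forall>z. h (0, z) = z) \<and> (\<forall>z. h (1, z) = \<phi> z))"

text \<open>\<open>\<phi>\<close> carries the drawing of the base graph to the drawing of the copy at \<open>s\<close>.  Copies are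
  taken up to ambient isotopy: \<open>\<phi>\<close> is an orientation preserving homeomorphism of the plane at a
  black vertex of the supergraph and an orientation reversing one at a white vertex.\<close>

definition places_copy ::
    "('v, 's, 't, 'l) compound \<Rightarrow> 's \<Rightarrow> (complex \<Rightarrow> complex) \<Rightarrow> bool" where
  "places_copy H s \<phi> \<longleftrightarrow>
     (s \<in> blacks (super H) \<longrightarrow> isotopic_to_id \<phi>) \<and>
     (s \<in> whites (super H) \<longrightarrow> isotopic_to_id (\<phi> \<circ> cnj)) \<and>
     (\<forall>v\<in>verts (base H). point (total_drawing H) (Base s v) = \<phi> (point (base_drawing H) v)) \<and>
     (\<forall>(b, w)\<in>edges (base H). path_image (curve (total_drawing H) (Base s b, Base s w)) =
        \<phi> ` path_image (curve (base_drawing H) (b, w)))"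

text \<open>The last condition says that every part of the drawing which does not belong to the copy at
  \<open>s\<close> (that is, the other copies, the stems, the leaves and their edges) lies in the outer face of
  that copy.\<close>

definition compound_graph :: "('v, 's, 't, 'l) compound \<Rightarrow> bool" where
  "compound_graph H \<longleftrightarrow>
     bipartite_graph (base H) \<and> plane_drawing (base H) (base_drawing H) \<and>
     card (blacks (base H)) = card (whites (base H)) \<and>
     bipartite_graph (super H) \<and> planar (super H) \<and>
     finite (stems H) \<and>
     (\<forall>t\<in>stems H. stem_edge H t \<in> edges (super H) \<and> stem_at H t \<in> whites (base H) \<and>
        on_outer_face (base H) (base_drawing H) (stem_at H t)) \<and>
     finite (leaves H) \<and> card (leaves H) = card (stems H) \<and>
     (\<forall>l\<in>leaves H. leaf_copy H l \<in> verts (super H) \<and> leaf_at H l \<in> blacks (base H) \<and>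
        on_outer_face (base H) (base_drawing H) (leaf_at H l)) \<and>
     plane_drawing (total_graph H) (total_drawing H) \<and>
     (\<forall>s\<in>verts (super H). \<exists>\<phi>. places_copy H s \<phi> \<and>
        drawn_set (total_graph H) (total_drawing H) - \<phi> ` drawn_set (base H) (base_drawing H)
          \<subseteq> outside (\<phi> ` drawn_set (base H) (base_drawing H)))"

text \<open>The set \<open>S(H)\<close>.\<close>

definition sign_functions ::
    "('v, 's, 't, 'l) compound \<Rightarrow>
     (('v, 's, 't, 'l) cvertex \<times> ('v, 's, 't, 'l) cvertex \<Rightarrow> int) set" where
  "sign_functions H =
     {\<sigma>. sign_function (total_graph H) (total_drawing H) \<sigma> \<and>
        (\<forall>s\<in>verts (super H). \<forall>s'\<in>verts (super H). \<forall>(b, w)\<in>edges (base H).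
           \<sigma> (Base s b, Base s w) = \<sigma> (Base s' b, Base s' w))}"

fun is_base :: "('v, 's, 't, 'l) cvertex \<Rightarrow> bool" where
  "is_base (Base s v) = True"
| "is_base (Stem t) = False"
| "is_base (Leaf l) = False"

fun compound_weight ::
    "('v \<times> 'v \<Rightarrow> 'r::idom) \<Rightarrow>
     ('v, 's, 't, 'l) cvertex \<times> ('v, 's, 't, 'l) cvertex \<Rightarrow> 'r" where
  "compound_weight wt (Base s b, Base s' w) = wt (b, w)"
| "compound_weight wt e = 1"

definition sign_weight ::
    "('v \<times> 'v \<Rightarrow> 'r::idom) \<Rightarrow>
     (('v, 's, 't, 'l) cvertex \<times> ('v, 's, 't, 'l) cvertex \<Rightarrow> int) \<Rightarrow>
     ('v, 's, 't, 'l) cvertex \<times> ('v, 's, 't, 'l) cvertex \<Rightarrow> 'r" where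
  "sign_weight wt \<sigma> e =
     (if is_base (fst e) \<and> is_base (snd e) then compound_weight wt e
      else of_int (\<sigma> e) * compound_weight wt e)"

definition sign_weighted_sum ::
    "('v, 's, 't, 'l) compound \<Rightarrow> ('v \<times> 'v \<Rightarrow> 'r::idom) \<Rightarrow>
     (('v, 's, 't, 'l) cvertex \<times> ('v, 's, 't, 'l) cvertex \<Rightarrow> int) \<Rightarrow> 'r" where
  "sign_weighted_sum H wt \<sigma> = matching_sum (total_graph H) (sign_weight wt \<sigma>)"

text \<open>\<open>H\<close> and its siblings with respect to the leaf \<open>p\<close>, where the new leaf \<open>p'\<close> of a sibling
  reuses the name \<open>p\<close>.  The plane drawing of a member is not unique: it may be any drawing allowed
  for a compound graph, so each \<open>s\<close> yields one member up to the choice of \<open>D\<close>.\<close>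

definition family ::
    "('v, 's, 't, 'l) compound \<Rightarrow> 'l \<Rightarrow> ('v, 's, 't, 'l) compound set" where
  "family H p =
     {H'. compound_graph H' \<and>
        (\<exists>s\<in>verts (super H). \<exists>D. H' = H\<lparr>leaf_copy := (leaf_copy H)(p := s), total_drawing := D\<rparr>)}"

end

theory Submission
  imports Defs "Jordan_Normal_Form.Determinant" "HOL-Combinatorics.Cycles"
begin

text \<open>The idea is to write every \<open>#H\<^sub>i\<close> of the family, up to sign, as a determinant, in such a way
  that the determinants differ in a single column, and to show that a signed sum of these columns
  depends linearly on the other columns.

  \<^bold>\<open>Determinants.\<close>  In the expansion of a determinant with rows indexed by the black and columns by the
  white vertices, the terms are the perfect matchings.  By Kasteleyn's argument
  (\<open>kasteleyn_sign\<close>) the sign of the permutation times the product of the \<open>\<sigma>\<close>-values of the matched edges is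
  the same for all perfect matchings: two matchings differ by alternating cycles, each of which
  encloses an even number of vertices, because the vertices inside are matched among themselves.
  Hence \<open>#H\<^sub>i\<close> is \<open>\<plusminus>\<close> the determinant with entry \<open>\<sigma> e * wt e\<close> at a base edge and \<open>1\<close> at an edge of a
  stem or leaf.

  \<^bold>\<open>Common signs.\<close>  The members of the family come with different sign functions, while the determinants
  must share their base entries.  Any two sign functions restrict to sign functions \<open>\<sigma>, \<sigma>'\<close> of the base
  graph, whose quotient \<open>\<tau> = \<sigma> \<sigma>'\<close> has product \<open>1\<close> around every cycle that encloses an even
  number of vertices.  Cycles that enclose an odd number may violate this.  They are harmless: a
  perfect matching of a compound graph cuts each copy down to a near matching, which misses only
  vertices of the outer face, and around cycles made of edges of near matchings \<open>\<tau>\<close> always has product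
  \<open>1\<close> (\<open>allowed_cycle_balanced\<close>).  So on these edges \<open>\<tau>\<close> is a gauge \<open>\<tau>(b, w) = \<alpha> b * \<alpha> w\<close>.  As stems and
  leaves are joined to equivalent vertices only, the gauge extends to the whole compound graph and
  contributes the same factor to every perfect matching (\<open>kasteleyn_entries\<close>).

  \<^bold>\<open>Linear dependence.\<close>  Let \<open>c s\<close> be \<open>1\<close> on black and \<open>-1\<close> on white vertices of the supergraph.  In the sum
  of the columns of \<open>Base s w\<close> with coefficients \<open>c s\<close> the rows of the stems cancel, since a stem joins the same
  \<open>w\<close> in two copies of opposite colours.  What remains is the column of \<open>w\<close> in the base graph,
  repeated with factor \<open>c s\<close> in copy \<open>s\<close>.  The columns of the moving leaf, summed with the same
  coefficients, have the same shape.  These are one more vector than the base graph has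
  black vertices, so they are linearly dependent
  (\<open>underdetermined_system\<close>, \<open>alternating_leaf_column_kernel\<close>).\<close>

section \<open>Determinants and linear systems over an integral domain\<close>

lemma sum_enum: 
  assumes "bij_betw e {0..<n} A" shows "(\<Sum>i\<in>{0..<n}. f (e i)) = (\<Sum>a\<in>A. f a)"
  using assms by (rule sum.reindex_bij_betw)

lemma mult_mat_vec_entry:
  assumes "i < (n::nat)"
  shows "Matrix.vec_index (Matrix.mat n n f *\<^sub>v Matrix.vec n v) i = (\<Sum>j\<in>{0..<n}. f (i, j) * v j)"
  using assms by (simp add: scalar_prod_def)

text \<open>Padding the coefficient matrix with zero rows makes it square and singular.\<close>

lemma underdetermined_system:
  fixes f :: "'b \<Rightarrow> 'w \<Rightarrow> 'r::idom"
  assumes "finite B" "finite W" "card B < card W"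
  shows "\<exists>x. (\<exists>w\<in>W. x w \<noteq> 0) \<and> (\<forall>b\<in>B. (\<Sum>w\<in>W. f b w * x w) = 0)"
proof -
  define n where "n = card W"
  obtain eb where eb: "bij_betw eb {0..<card B} B"
    using ex_bij_betw_nat_finite[OF assms(1)] by blast
  obtain ew where ew: "bij_betw ew {0..<n} W"
    using ex_bij_betw_nat_finite[OF assms(2)] n_def by blast
  define A where "A = Matrix.mat n n (\<lambda>(i, j). if i < card B then f (eb i) (ew j) else 0)"
  have A: "A \<in> carrier_mat n n" by (simp add: A_def)
  have "Determinant.det A = 0"
    unfolding det_def'[OF A]
  proof (rule sum.neutral, rule ballI)
    fix p assume "p \<in> {p. p permutes {0..<n}}"
    hence "p (n - 1) < n"
      using permutes_in_image[of p "{0..<n}" "n - 1"] assms(3) n_def by auto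
    hence "A $$ (n - 1, p (n - 1)) = 0"
      using assms(3) by (simp add: A_def n_def)
    moreover have "n - 1 \<in> {0..<n}" using assms(3) n_def by auto
    ultimately have "(\<Prod>i = 0..<n. A $$ (i, p i)) = 0" by (auto intro: prod_zero)
    thus "signof p * (\<Prod>i = 0..<n. A $$ (i, p i)) = 0" by simp
  qed
  then obtain v where v: "v \<in> carrier_vec n" "v \<noteq> 0\<^sub>v n" "A *\<^sub>v v = 0\<^sub>v n"
    using det_0_iff_vec_prod_zero[OF A] by auto
  define x where "x = (\<lambda>w. Matrix.vec_index v (inv_into {0..<n} ew w))"
  have xe: "x (ew j) = Matrix.vec_index v j" if "j < n" for j
    using ew that by (simp add: x_def bij_betw_def)
  have "\<exists>w\<in>W. x w \<noteq> 0"
  proof -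
    obtain j where "j < n" "Matrix.vec_index v j \<noteq> 0"
      using v(1,2) by (metis carrier_vecD eq_vecI index_zero_vec(1) index_zero_vec(2))
    thus ?thesis using xe[of j] bij_betwE[OF ew] by force
  qed
  moreover have "(\<Sum>w\<in>W. f b w * x w) = 0" if b: "b \<in> B" for b
  proof -
    obtain i where i: "i < card B" "b = eb i"
      using eb b by (metis atLeastLessThan_iff bij_betw_iff_bijections)
    have i': "i < n" using i assms(3) n_def by simp
    have "v = Matrix.vec n (\<lambda>j. Matrix.vec_index v j)" using v(1) by (intro eq_vecI) auto
    then have "0 = Matrix.vec_index (A *\<^sub>v Matrix.vec n (\<lambda>j. Matrix.vec_index v j)) i"
      using v(3) i' by simp
    also have "\<dots> = (\<Sum>j\<in>{0..<n}. f b (ew j) * x (ew j))"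
      unfolding A_def mult_mat_vec_entry[OF i'] using i xe by (auto intro!: sum.cong)
    also have "\<dots> = (\<Sum>w\<in>W. f b w * x w)" by (rule sum_enum[OF ew])
    finally show ?thesis by simp
  qed
  ultimately show ?thesis by blast
qed

text \<open>The sum is a determinant whose rows and columns are enumerated by \<open>eb\<close> and \<open>ew\<close>, and \<open>y\<close> is a
  nonzero vector in its kernel.\<close>

lemma signed_permutation_sum_eq_0:
  fixes F :: "'b \<Rightarrow> 'w \<Rightarrow> 'r::idom"
  assumes eb: "bij_betw eb {0..<n::nat} B" and ew: "bij_betw ew {0..<n} W"
    and y: "\<exists>w\<in>W. y w \<noteq> 0" and ker: "\<And>b. b \<in> B \<Longrightarrow> (\<Sum>w\<in>W. F b w * y w) = 0"
  shows "(\<Sum>p | p permutes {0..<n}. of_int (sign p) * (\<Prod>i=0..<n. F (eb i) (ew (p i)))) = 0"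
proof -
  define A where "A = Matrix.mat n n (\<lambda>(i, j). F (eb i) (ew j))"
  have A: "A \<in> carrier_mat n n" by (simp add: A_def)
  define v where "v = Matrix.vec n (\<lambda>j. y (ew j))"
  have "v \<in> carrier_vec n" by (simp add: v_def)
  moreover have "v \<noteq> 0\<^sub>v n"
  proof
    assume v0: "v = 0\<^sub>v n"
    obtain j where "j < n" "y (ew j) \<noteq> 0"
      using y ew by (metis atLeastLessThan_iff bij_betw_iff_bijections)
    thus False using arg_cong[OF v0, of "\<lambda>u. Matrix.vec_index u j"] by (simp add: v_def)
  qed
  moreover have "A *\<^sub>v v = 0\<^sub>v n"
  proof (rule eq_vecI)
    fix i assume "i < dim_vec (0\<^sub>v n :: 'r Matrix.vec)"
    hence i: "i < n" by simp
    have "eb i \<in> B" using eb i by (auto simp: bij_betw_def)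
    have "Matrix.vec_index (A *\<^sub>v v) i = (\<Sum>j\<in>{0..<n}. F (eb i) (ew j) * y (ew j))"
      unfolding A_def v_def mult_mat_vec_entry[OF i] by simp
    also have "\<dots> = (\<Sum>w\<in>W. F (eb i) w * y w)" by (rule sum_enum[OF ew])
    also have "\<dots> = 0" by (rule ker[OF \<open>eb i \<in> B\<close>])
    finally show "Matrix.vec_index (A *\<^sub>v v) i = Matrix.vec_index (0\<^sub>v n) i" using i by simp
  qed (simp add: A_def)
  ultimately have "Determinant.det A = 0"
    using det_0_iff_vec_prod_zero[OF A] by blast
  moreover have "Determinant.det A =
      (\<Sum>p | p permutes {0..<n}. of_int (sign p) * (\<Prod>i=0..<n. F (eb i) (ew (p i))))"
    unfolding det_def'[OF A]
  proof (intro sum.cong refl)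
    fix p assume "p \<in> {p. p permutes {0..<n}}"
    hence "p i < n" if "i < n" for i using permutes_in_image[of p "{0..<n}" i] that by simp
    thus "signof p * (\<Prod>i = 0..<n. A $$ (i, p i)) =
        of_int (sign p) * (\<Prod>i=0..<n. F (eb i) (ew (p i)))"
      by (auto simp: A_def intro!: prod.cong)
  qed
  ultimately show ?thesis by simp
qed

text \<open>Linearity of the determinant in the column \<open>w0\<close>: every permutation meets that column exactly once.\<close>

lemma signed_permutation_sum_column:
  fixes F :: "'i \<Rightarrow> 'b \<Rightarrow> 'w \<Rightarrow> 'r::idom"
  assumes "finite I" and ew: "bij_betw ew {0..<n::nat} W" and "w0 \<in> W"
    and same: "\<And>i b w. i \<in> I \<Longrightarrow> w \<noteq> w0 \<Longrightarrow> F i b w = F' b w"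
    and comb: "\<And>b. F' b w0 = (\<Sum>i\<in>I. c i * F i b w0)"
  shows "(\<Sum>i\<in>I. c i * (\<Sum>p | p permutes {0..<n}.
             of_int (sign p) * (\<Prod>j=0..<n. F i (eb j) (ew (p j))))) =
         (\<Sum>p | p permutes {0..<n}. of_int (sign p) * (\<Prod>j=0..<n. F' (eb j) (ew (p j))))"
proof -
  have "(\<Sum>i\<in>I. c i * (\<Prod>j=0..<n. F i (eb j) (ew (p j)))) = (\<Prod>j=0..<n. F' (eb j) (ew (p j)))"
    if p: "p permutes {0..<n}" for p
  proof -
    have "bij_betw (\<lambda>j. ew (p j)) {0..<n} W"
      using bij_betw_trans[OF permutes_imp_bij[OF p] ew] by (simp add: comp_def)
    then obtain j0 where j0: "j0 \<in> {0..<n}" "ew (p j0) = w0"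
        and inj: "\<And>j. j \<in> {0..<n} \<Longrightarrow> ew (p j) = w0 \<Longrightarrow> j = j0"
      using \<open>w0 \<in> W\<close> by (smt (verit) bij_betw_iff_bijections)
    have "(\<Prod>j=0..<n. F i (eb j) (ew (p j))) =
        F i (eb j0) w0 * (\<Prod>j\<in>{0..<n} - {j0}. F' (eb j) (ew (p j)))" if "i \<in> I" for i
    proof -
      have "(\<Prod>j\<in>{0..<n} - {j0}. F i (eb j) (ew (p j))) =
          (\<Prod>j\<in>{0..<n} - {j0}. F' (eb j) (ew (p j)))"
        using inj same[OF that] by (intro prod.cong refl) blast
      thus ?thesis using j0 by (subst prod.remove[of _ j0]) auto
    qed
    moreover have "(\<Prod>j=0..<n. F' (eb j) (ew (p j))) =
        F' (eb j0) w0 * (\<Prod>j\<in>{0..<n} - {j0}. F' (eb j) (ew (p j)))"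
      using j0 by (subst prod.remove[of _ j0]) auto
    ultimately show ?thesis
      by (simp add: comb sum_distrib_right mult.assoc)
  qed
  note each = this
  have "(\<Sum>i\<in>I. c i * (\<Sum>p | p permutes {0..<n}.
             of_int (sign p) * (\<Prod>j=0..<n. F i (eb j) (ew (p j))))) =
        (\<Sum>p | p permutes {0..<n}. of_int (sign p) *
           (\<Sum>i\<in>I. c i * (\<Prod>j=0..<n. F i (eb j) (ew (p j)))))"
    unfolding sum_distrib_left by (subst sum.swap) (simp add: mult.left_commute)
  thus ?thesis by (simp add: each)
qed

section \<open>Plane drawings and enclosed vertices\<close>

locale plane_bgraph =
  fixes G :: "'v bgraph" and D :: "'v drawing"
  assumes bipartite: "bipartite_graph G" and drawing: "plane_drawing G D"
begin

definition img :: "('v \<times> 'v) set \<Rightarrow> complex set" where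
  "img F = (\<Union>e\<in>F. path_image (curve D e))"

definition ends :: "('v \<times> 'v) set \<Rightarrow> 'v set" where
  "ends F = fst ` F \<union> snd ` F"

lemma ends_Un: "ends (F \<union> F') = ends F \<union> ends F'"
  by (auto simp: ends_def)

lemma img_Un: "img (F \<union> F') = img F \<union> img F'"
  by (auto simp: img_def)

lemma enclosed_verts_img: "enclosed_verts G D F = {v \<in> verts G. point D v \<in> inside (img F)}"
  by (simp add: enclosed_verts_def img_def)

lemma finite_verts: "finite (verts G)"
  using bipartite by (simp add: bipartite_graph_def verts_def)

lemma finite_edges: "finite (edges G)"
  using bipartite by (auto simp: bipartite_graph_def intro: finite_subset)

lemma edgeD:
  assumes "(b, w) \<in> edges G"
  shows "b \<in> blacks G" "w \<in> whites G" "b \<in> verts G" "w \<in> verts G" "b \<noteq> w" "(w, b) \<notin> edges G"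
  using assms bipartite by (auto simp: bipartite_graph_def verts_def)

lemma edge_colours: "e \<in> edges G \<Longrightarrow> fst e \<in> blacks G \<and> snd e \<in> whites G"
  using bipartite by (auto simp: bipartite_graph_def)

lemma ends_edges: "F \<subseteq> edges G \<Longrightarrow> ends F \<subseteq> verts G"
  using edge_colours by (auto simp: ends_def verts_def)

lemma arc_curve:
  assumes "(b, w) \<in> edges G"
  shows "arc (curve D (b, w))" "pathstart (curve D (b, w)) = point D b"
    "pathfinish (curve D (b, w)) = point D w"
  using assms drawing by (auto simp: plane_drawing_def)

lemma point_eq_iff: "u \<in> verts G \<Longrightarrow> v \<in> verts G \<Longrightarrow> point D u = point D v \<longleftrightarrow> u = v"
  using drawing by (auto simp: plane_drawing_def inj_on_def)

lemma point_on_curve: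
  assumes "e \<in> edges G" "v \<in> verts G" "point D v \<in> path_image (curve D e)"
  shows "v = fst e \<or> v = snd e"
  using assms drawing unfolding plane_drawing_def by blast

lemma ends_on_curve:
  assumes "e \<in> edges G" 
  shows "point D (fst e) \<in> path_image (curve D e)" "point D (snd e) \<in> path_image (curve D e)"
  using arc_curve[of "fst e" "snd e"] assms
  by (metis prod.collapse pathstart_in_path_image, metis prod.collapse pathfinish_in_path_image)

lemma curves_meet:
  assumes "e \<in> edges G" "f \<in> edges G" "e \<noteq> f"
    and "z \<in> path_image (curve D e)" "z \<in> path_image (curve D f)"
  shows "\<exists>v. z = point D v \<and> v \<in> {fst e, snd e} \<inter> {fst f, snd f}"
proof -
  have "z \<in> point D ` verts G" using assms drawing unfolding plane_drawing_def by blast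
  then obtain v where v: "v \<in> verts G" "z = point D v" by blast
  thus ?thesis using point_on_curve[OF assms(1) v(1)] point_on_curve[OF assms(2) v(1)] assms by blast
qed

lemma img_meet:
  assumes "F \<subseteq> edges G" "F' \<subseteq> edges G" "F \<inter> F' = {}"
  shows "img F \<inter> img F' \<subseteq> point D ` (ends F \<inter> ends F')"
proof
  fix z assume "z \<in> img F \<inter> img F'"
  then obtain e f where ef: "e \<in> F" "f \<in> F'" "z \<in> path_image (curve D e)" "z \<in> path_image (curve D f)"
    by (auto simp: img_def)
  obtain v where "z = point D v" "v \<in> {fst e, snd e} \<inter> {fst f, snd f}"
    using curves_meet[of e f z] ef assms by blast
  thus "z \<in> point D ` (ends F \<inter> ends F')" using ef by (auto simp: ends_def)
qed

lemma point_in_img: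
  assumes "F \<subseteq> edges G" "v \<in> verts G"
  shows "point D v \<in> img F \<longleftrightarrow> v \<in> ends F"
proof
  assume "point D v \<in> img F"
  then obtain e where "e \<in> F" "point D v \<in> path_image (curve D e)" by (auto simp: img_def)
  thus "v \<in> ends F" using point_on_curve[of e v] assms by (auto simp: ends_def)
next
  assume "v \<in> ends F"
  thus "point D v \<in> img F"
    using assms(1) ends_on_curve by (force simp: ends_def img_def)
qed

lemma closed_img: "F \<subseteq> edges G \<Longrightarrow> closed (img F)"
proof -
  assume F: "F \<subseteq> edges G"
  have "finite F" using F finite_edges finite_subset by blast
  moreover have "closed (path_image (curve D e))" if "e \<in> F" for e
    using arc_curve(1)[of "fst e" "snd e"] that F by (auto intro: closed_path_image arc_imp_path)
  ultimately show ?thesis by (auto simp: img_def)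
qed

lemma enclosed_not_end:
  assumes "F \<subseteq> edges G" "v \<in> enclosed_verts G D F" shows "v \<notin> ends F"
  using assms point_in_img[OF assms(1), of v] inside_no_overlap[of "img F"] unfolding disjoint_iff
  by (auto simp: enclosed_verts_img)

text \<open>An edge of the graph cannot cross a set of other edges, so it leaves the region that they
  enclose only through one of their endpoints.\<close>

lemma enclosed_step:
  assumes F: "F \<subseteq> edges G" and e: "e \<in> edges G"
    and u: "u \<in> {fst e, snd e}" "u \<in> enclosed_verts G D F" and v: "v \<in> {fst e, snd e}"
  shows "v \<in> enclosed_verts G D F \<or> v \<in> ends F"
proof (cases "v \<in> ends F")
  case False
  have "u \<notin> ends F" using enclosed_not_end F u by blast
  have eV: "fst e \<in> verts G" "snd e \<in> verts G" using edgeD[of "fst e" "snd e"] e by auto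
  show ?thesis
  proof (cases "u = v")
    case True thus ?thesis using u by simp
  next
    case uv: False
    have "path_image (curve D e) \<inter> img F = {}"
    proof -
      have "e \<notin> F" using \<open>u \<notin> ends F\<close> u(1) by (auto simp: ends_def)
      hence "img {e} \<inter> img F \<subseteq> point D ` (ends {e} \<inter> ends F)"
        using img_meet[of "{e}" F] e F by auto
      moreover have "ends {e} \<inter> ends F = {}"
        using uv u(1) v \<open>u \<notin> ends F\<close> False by (auto simp: ends_def)
      ultimately show ?thesis by (simp add: img_def)
    qed
    moreover have "connected (path_image (curve D e))"
      using arc_curve(1)[of "fst e" "snd e"] e
      by (auto intro!: connected_path_image arc_imp_path)
    moreover have "point D u \<in> path_image (curve D e)" "point D v \<in> path_image (curve D e)"
      using ends_on_curve[OF e] u(1) v by auto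
    ultimately have "connected_component (- img F) (point D u) (point D v)"
      by (metis connected_component_def disjoint_eq_subset_Compl)
    hence "point D v \<in> inside (img F)"
      using inside_same_component u(2) by (auto simp: enclosed_verts_img)
    thus ?thesis using eV v by (auto simp: enclosed_verts_img)
  qed
qed simp

definition matching :: "('v \<times> 'v) set \<Rightarrow> bool" where
  "matching N \<longleftrightarrow> N \<subseteq> edges G \<and> (\<forall>e\<in>N. \<forall>f\<in>N. {fst e, snd e} \<inter> {fst f, snd f} \<noteq> {} \<longrightarrow> e = f)"

text \<open>A matching inside \<open>X\<close> pairs its black vertices with its white ones.\<close>

lemma even_card_if_matched:
  assumes N: "matching N" and X: "X \<subseteq> verts G"
    and closed: "\<And>v. v \<in> X \<Longrightarrow> \<exists>e\<in>N. v \<in> {fst e, snd e} \<and> fst e \<in> X \<and> snd e \<in> X"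
  shows "even (card X)"
proof -
  define N' where "N' = {e \<in> N. fst e \<in> X \<and> snd e \<in> X}"
  have E: "N' \<subseteq> edges G" using N by (auto simp: N'_def matching_def)
  have "inj_on fst N'" "inj_on snd N'"
    using N by (auto simp: N'_def matching_def inj_on_def)
  moreover have "fst ` N' = X \<inter> blacks G"
  proof
    show "fst ` N' \<subseteq> X \<inter> blacks G" using E edge_colours by (auto simp: N'_def)
    show "X \<inter> blacks G \<subseteq> fst ` N'"
    proof
      fix v assume v: "v \<in> X \<inter> blacks G"
      then obtain e where e: "e \<in> N'" "v \<in> {fst e, snd e}" using closed[of v] by (auto simp: N'_def)
      have "v \<noteq> snd e" using v e(1) E edgeD[of "fst e" "snd e"] bipartite
        by (auto simp: bipartite_graph_def)
      thus "v \<in> fst ` N'" using e by auto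
    qed
  qed
  moreover have "snd ` N' = X \<inter> whites G"
  proof
    show "snd ` N' \<subseteq> X \<inter> whites G" using E edge_colours by (auto simp: N'_def)
    show "X \<inter> whites G \<subseteq> snd ` N'"
    proof
      fix v assume v: "v \<in> X \<inter> whites G"
      then obtain e where e: "e \<in> N'" "v \<in> {fst e, snd e}" using closed[of v] by (auto simp: N'_def)
      have "v \<noteq> fst e" using v e(1) E edgeD[of "fst e" "snd e"] bipartite
        by (auto simp: bipartite_graph_def)
      thus "v \<in> snd ` N'" using e by auto
    qed
  qed
  ultimately have c: "card (X \<inter> blacks G) = card N'" "card (X \<inter> whites G) = card N'"
    using card_image[of fst N'] card_image[of snd N'] by simp_all
  have "card X = card ((X \<inter> blacks G) \<union> (X \<inter> whites G))"
    using X by (intro arg_cong[of _ _ card]) (auto simp: verts_def)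
  also have "\<dots> = card (X \<inter> blacks G) + card (X \<inter> whites G)"
    using bipartite by (intro card_Un_disjoint) (auto simp: bipartite_graph_def)
  finally show ?thesis using c by simp
qed

end

section \<open>Cycles as vertex lists\<close>

text \<open>The adjacent pairs of a list, in both orders: edges are stored with the black endpoint first, whereas a
  walk may run through an edge in either direction.\<close>

fun steps :: "'a list \<Rightarrow> ('a \<times> 'a) set" where
  "steps (u # v # r) = {(u, v), (v, u)} \<union> steps (v # r)"
| "steps [u] = {}"
| "steps [] = {}"

lemma steps_append: "steps (A @ x # B) = steps (A @ [x]) \<union> steps (x # B)"
proof (induction A)
  case (Cons a A) thus ?case by (cases A) auto
qed simp

lemma steps_subset: "steps vs \<subseteq> set vs \<times> set vs"
  by (induction vs rule: steps.induct) auto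

lemma steps_irrefl: "distinct vs \<Longrightarrow> (x, x) \<notin> steps vs"
  by (induction vs rule: steps.induct) auto

lemma steps_rev: "steps (rev vs) = steps vs"
proof (induction vs rule: steps.induct)
  case (1 u v r)
  have "steps (rev (u # v # r)) = steps (rev r @ v # [u])" by simp
  also have "\<dots> = steps (rev (v # r)) \<union> steps (v # [u])" by (subst steps_append) simp
  finally show ?case using 1 by auto
qed auto

text \<open>A step between the two ends of a path with an inner vertex would make the path revisit one of them.\<close>

lemma steps_chord:
  assumes "distinct (c # A @ [c'])" "A \<noteq> []" "(x, y) \<in> steps (c # A @ [c'])"
  shows "x \<notin> {c, c'} \<or> y \<notin> {c, c'}"
proof -
  obtain a A' where A: "A = a # A'" using assms(2) by (cases A) auto
  have "(x, y) \<in> {(c, a), (a, c)} \<or> (x, y) \<in> steps (a # A' @ [c'])"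
    using assms(3) A by auto
  thus ?thesis
  proof
    assume "(x, y) \<in> {(c, a), (a, c)}" thus ?thesis using assms(1) A by auto
  next
    assume s: "(x, y) \<in> steps (a # A' @ [c'])"
    hence "x \<in> set (a # A' @ [c'])" "y \<in> set (a # A' @ [c'])" using steps_subset by fast+
    hence "x \<noteq> c" "y \<noteq> c" using assms(1) A by auto
    moreover have "x \<noteq> y" using s steps_irrefl[of "a # A' @ [c']"] assms(1) A by auto
    ultimately show ?thesis by auto
  qed
qed

lemma steps_disjoint:
  assumes "distinct (c # A @ [c'])" "A \<noteq> []" "set (c # A @ [c']) \<inter> X \<subseteq> {c, c'}" "Y \<subseteq> X \<times> X"
  shows "steps (c # A @ [c']) \<inter> Y = {}"
proof (rule equals0I)
  fix e assume e: "e \<in> steps (c # A @ [c']) \<inter> Y"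
  obtain x y where xy: "e = (x, y)" by (cases e)
  have "x \<in> set (c # A @ [c'])" "y \<in> set (c # A @ [c'])" using e xy steps_subset by fast+
  moreover have "x \<in> X" "y \<in> X" using e xy assms(4) by auto
  ultimately have "x \<in> {c, c'}" "y \<in> {c, c'}" using assms(3) by blast+
  thus False using steps_chord[OF assms(1,2)] e xy by blast
qed

definition closed_steps :: "'a list \<Rightarrow> ('a \<times> 'a) set" where
  "closed_steps vs = steps (vs @ [hd vs])"

lemma closed_steps_rotate: "closed_steps (X @ c # Y) = closed_steps (c # Y @ X)"
proof (cases X)
  case (Cons x X')
  have "closed_steps (X @ c # Y) = steps (X @ c # (Y @ [x]))"
    by (simp add: closed_steps_def Cons)
  also have "\<dots> = steps (X @ [c]) \<union> steps (c # Y @ [x])" by (rule steps_append)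
  also have "\<dots> = steps (c # Y @ [x]) \<union> steps (x # X' @ [c])" using Cons by auto
  also have "\<dots> = steps ((c # Y) @ x # (X' @ [c]))"
    by (subst steps_append) simp
  finally show ?thesis by (simp add: closed_steps_def Cons)
qed (simp add: closed_steps_def)

lemma closed_steps_split:
  "closed_steps (c # A @ c' # B) = steps (c # A @ [c']) \<union> steps (c' # B @ [c])"
proof -
  have "closed_steps (c # A @ c' # B) = steps ((c # A) @ c' # (B @ [c]))"
    by (simp add: closed_steps_def)
  thus ?thesis by (subst (asm) steps_append) simp
qed

text \<open>A cycle may be read off as two paths between any two of its vertices.\<close>

lemma closed_steps_rotate_to:
  assumes "distinct vs" "c \<in> set vs" "c' \<in> set vs" "c \<noteq> c'"
  obtains A B where "closed_steps (c # A @ c' # B) = closed_steps vs"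
    "distinct (c # A @ c' # B)" "set (c # A @ c' # B) = set vs" "length (c # A @ c' # B) = length vs"
proof -
  obtain X Y where v: "vs = X @ c # Y" using assms(2) by (meson split_list)
  hence "c' \<in> set (Y @ X)" using assms by auto
  then obtain A B where AB: "Y @ X = A @ c' # B" by (meson split_list)
  have w: "c # Y @ X = c # A @ c' # B" using AB by simp
  have "closed_steps (c # A @ c' # B) = closed_steps vs"
    unfolding w[symmetric] v by (rule closed_steps_rotate[symmetric])
  moreover have "distinct (c # A @ c' # B)" "set (c # A @ c' # B) = set vs"
     "length (c # A @ c' # B) = length vs"
    unfolding w[symmetric] using v assms(1) by auto
  ultimately show thesis by (rule that)
qed

text \<open>A path is extended by one vertex at a time and cut back at the first repetition.\<close>

lemma rtrancl_obtain_path: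
  assumes "(a, b) \<in> R\<^sup>*" and sym: "sym R"
  obtains P where "P \<noteq> []" "hd P = a" "last P = b" "distinct P" "steps P \<subseteq> R" "set P \<subseteq> R\<^sup>* `` {a}"
proof -
  have "\<exists>P. P \<noteq> [] \<and> hd P = a \<and> last P = b \<and> distinct P \<and> steps P \<subseteq> R \<and> set P \<subseteq> R\<^sup>* `` {a}"
    using assms(1)
  proof (induction rule: rtrancl_induct)
    case base
    show ?case by (rule exI[of _ "[a]"]) auto
  next
    case (step y z)
    then obtain P where P: "P \<noteq> []" "hd P = a" "last P = y" "distinct P" "steps P \<subseteq> R"
      "set P \<subseteq> R\<^sup>* `` {a}" by blast
    show ?case
    proof (cases "z \<in> set P")
      case True
      then obtain X Y where XY: "P = X @ z # Y" by (meson split_list)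
      have "steps (X @ [z]) \<subseteq> R" using P(5) unfolding XY by (subst (asm) steps_append) simp
      moreover have "hd (X @ [z]) = a" using P(2) XY by (cases X) auto
      ultimately show ?thesis
        using P XY by (intro exI[of _ "X @ [z]"]) auto
    next
      case False
      obtain Q where Q: "P = Q @ [y]" using P(1,3) by (metis append_butlast_last_id)
      have "steps (P @ [z]) = steps P \<union> steps [y, z]"
        unfolding Q using steps_append[of Q y "[z]"] by simp
      also have "\<dots> \<subseteq> R" using P(5) step.hyps(2) sym by (auto simp: sym_def)
      finally have "steps (P @ [z]) \<subseteq> R" .
      moreover have "(a, z) \<in> R\<^sup>*" using step.hyps by auto
      ultimately show ?thesis
        using P False by (intro exI[of _ "P @ [z]"]) auto
    qed
  qed
  thus thesis using that by blast
qed

fun interleave :: "'a list \<Rightarrow> 'a list \<Rightarrow> 'a list" where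
  "interleave (b # bs) (w # ws) = b # w # interleave bs ws"
| "interleave _ _ = []"

lemma set_interleave: "length bs = length ws \<Longrightarrow> set (interleave bs ws) = set bs \<union> set ws"
  by (induction bs ws rule: interleave.induct) auto

lemma distinct_interleave:
  "length bs = length ws \<Longrightarrow> distinct (interleave bs ws) \<Longrightarrow> distinct bs \<and> distinct ws"
  by (induction bs ws rule: interleave.induct) (auto simp: set_interleave)

lemma length_interleave: "length bs = length ws \<Longrightarrow> length (interleave bs ws) = 2 * length bs"
  by (induction bs ws rule: interleave.induct) auto

lemma steps_interleave:
  assumes "length bs = length ws"
  defines "S \<equiv> (\<lambda>bs ws x. \<Union>i<length bs. {(bs ! i, ws ! i), ((bs @ [x]) ! Suc i, ws ! i)})"
  shows "steps (interleave bs ws @ [x]) = S bs ws x \<union> (S bs ws x)\<inverse>"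
  using assms(1)
proof (induction bs ws rule: list_induct2)
  case Nil thus ?case by (simp add: S_def)
next
  case (Cons b bs w ws)
  have S: "S (b # bs) (w # ws) x = {(b, w), (hd (bs @ [x]), w)} \<union> S bs ws x"
  proof -
    have "{..<length (b # bs)} = insert 0 (Suc ` {..<length bs})"
      by (simp add: lessThan_Suc_eq_insert_0)
    thus ?thesis unfolding S_def by (auto simp: hd_conv_nth nth_append)
  qed
  have "steps (interleave (b # bs) (w # ws) @ [x]) =
      {(b, w), (w, b)} \<union> steps (w # interleave bs ws @ [x])" by simp
  also have "steps (w # interleave bs ws @ [x]) =
      {(w, hd (bs @ [x])), (hd (bs @ [x]), w)} \<union> steps (interleave bs ws @ [x])"
    using Cons.hyps by (cases bs; cases ws) auto
  finally show ?case using Cons.IH S by auto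
qed

context plane_bgraph
begin

definition trace :: "'v list \<Rightarrow> ('v \<times> 'v) set" where
  "trace vs = edges G \<inter> steps vs"

definition ctrace :: "'v list \<Rightarrow> ('v \<times> 'v) set" where
  "ctrace vs = edges G \<inter> closed_steps vs"

definition cycle_in :: "('v \<times> 'v) set \<Rightarrow> 'v list \<Rightarrow> bool" where
  "cycle_in F vs \<longleftrightarrow> distinct vs \<and> 3 \<le> length vs \<and> closed_steps vs \<subseteq> F \<union> F\<inverse>"

lemma edges_Int_sym:
  assumes "F \<subseteq> edges G" "S \<subseteq> F \<union> F\<inverse>" shows "edges G \<inter> S \<subseteq> F"
  using assms edgeD(6) by blast

lemma trace_subset: "F \<subseteq> edges G \<Longrightarrow> steps vs \<subseteq> F \<union> F\<inverse> \<Longrightarrow> trace vs \<subseteq> F"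
  unfolding trace_def by (rule edges_Int_sym)

lemma ends_trace: "ends (trace vs) \<subseteq> set vs"
  using steps_subset[of vs] by (auto simp: ends_def trace_def)

lemma finite_trace: "finite (trace vs)" "finite (ctrace vs)"
  using finite_edges by (auto simp: trace_def ctrace_def)

lemma ends_closed_trace:
  assumes "cycle_in (edges G) vs" shows "ends (ctrace vs) = set vs"
proof
  have "vs \<noteq> []" using assms by (auto simp: cycle_in_def)
  hence "set (vs @ [hd vs]) = set vs" by (auto)
  thus "ends (ctrace vs) \<subseteq> set vs"
    using steps_subset[of "vs @ [hd vs]"] by (auto simp: ends_def ctrace_def closed_steps_def)
  show "set vs \<subseteq> ends (ctrace vs)"
  proof
    fix c assume c: "c \<in> set vs"
    obtain X Y where XY: "vs = X @ c # Y" using c by (meson split_list)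
    obtain d Z where d: "Y @ X @ [c] = d # Z" by (cases "Y @ X @ [c]") auto
    have "closed_steps vs = steps (c # d # Z)"
      unfolding XY closed_steps_rotate by (simp add: closed_steps_def d[symmetric])
    hence "(c, d) \<in> closed_steps vs" "(d, c) \<in> closed_steps vs" by auto
    thus "c \<in> ends (ctrace vs)"
      using assms unfolding cycle_in_def ctrace_def ends_def by force
  qed
qed

lemma alternating_list:
  assumes "steps vs \<subseteq> edges G \<union> (edges G)\<inverse>" "vs \<noteq> []" "hd vs \<in> blacks G" "last vs \<in> whites G"
  shows "\<exists>bs ws. length bs = length ws \<and> vs = interleave bs ws \<and> set bs \<subseteq> blacks G"
  using assms
proof (induction "length vs" arbitrary: vs rule: less_induct)
  case less
  obtain x r where vs: "vs = x # r" using less.prems by (cases vs) auto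
  have "r \<noteq> []" using less.prems vs bipartite by (auto simp: bipartite_graph_def)
  then obtain y r' where r: "r = y # r'" by (cases r) auto
  have xy: "(x, y) \<in> edges G" using less.prems vs r edge_colours bipartite
    by (fastforce simp: bipartite_graph_def)
  show ?case
  proof (cases r')
    case Nil thus ?thesis using vs r by (intro exI[of _ "[x]"] exI[of _ "[y]"]) (use less.prems in auto)
  next
    case (Cons z r'')
    have "(y, z) \<in> edges G \<union> (edges G)\<inverse>" using less.prems(1) vs r Cons by auto
    moreover have "(y, z) \<notin> edges G" using xy edgeD bipartite by (auto simp: bipartite_graph_def)
    ultimately have "(z, y) \<in> edges G" by auto
    hence "z \<in> blacks G" by (rule edgeD)
    then obtain bs ws where "length bs = length ws" "r' = interleave bs ws" "set bs \<subseteq> blacks G"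
      using less.hyps[of r'] less.prems vs r Cons by auto
    thus ?thesis using vs r by (intro exI[of _ "x # bs"] exI[of _ "y # ws"]) (use less.prems in auto)
  qed
qed

text \<open>Colours alternate along a cycle, so that, after a rotation by at most one place, the list starts with
  a black vertex and consists of black and white vertices in turn.\<close>

lemma cycle_in_simple_cycle:
  assumes cyc: "cycle_in (edges G) vs"
  obtains bs ws where "simple_cycle G bs ws" "cycle_edges bs ws = ctrace vs"
proof -
  have *: thesis if cyc: "cycle_in (edges G) vs" and black: "hd vs \<in> blacks G"
      and that: "\<And>bs ws. simple_cycle G bs ws \<Longrightarrow> cycle_edges bs ws = ctrace vs \<Longrightarrow> thesis" for vs
  proof -
    have ne: "vs \<noteq> []" using cyc by (auto simp: cycle_in_def)
    obtain vs' where vs': "vs = vs' @ [last vs]" using ne by (metis append_butlast_last_id)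
    have cs: "closed_steps vs = steps vs \<union> steps [last vs, hd vs]"
      unfolding closed_steps_def using steps_append[of vs' "last vs" "[hd vs]"] vs'
      by (metis append.assoc append_Cons append_Nil)
    hence s: "steps vs \<subseteq> edges G \<union> (edges G)\<inverse>" and "(last vs, hd vs) \<in> edges G \<union> (edges G)\<inverse>"
      using cyc by (auto simp: cycle_in_def)
    moreover have "(last vs, hd vs) \<notin> edges G"
      using black edgeD(2) bipartite by (auto simp: bipartite_graph_def)
    ultimately have "last vs \<in> whites G" using edgeD(2) by blast
    then obtain bs ws where bw: "length bs = length ws" "vs = interleave bs ws" and b: "set bs \<subseteq> blacks G"
      using alternating_list[OF s ne black] by blast
    have d: "distinct bs" "distinct ws" 
      using distinct_interleave[OF bw(1)] cyc bw by (auto simp: cycle_in_def)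
    have l: "2 \<le> length bs" using length_interleave[OF bw(1)] cyc bw by (auto simp: cycle_in_def)
    have hd: "hd vs = bs ! 0" using bw l by (cases bs; cases ws) auto
    have "(\<Union>i<length bs. {(bs ! i, ws ! i), ((bs @ [bs ! 0]) ! Suc i, ws ! i)}) = cycle_edges bs ws"
      unfolding cycle_edges_def
    proof (intro SUP_cong refl)
      fix i assume i: "i \<in> {..<length bs}"
      have "(bs @ [bs ! 0]) ! Suc i = bs ! (Suc i mod length bs)"
      proof (cases "Suc i = length bs")
        case False
        hence "Suc i < length bs" using i by auto
        thus ?thesis by (simp add: nth_append)
      qed (use l in \<open>simp add: nth_append\<close>)
      thus "{(bs ! i, ws ! i), ((bs @ [bs ! 0]) ! Suc i, ws ! i)} =
        {(bs ! i, ws ! i), (bs ! (Suc i mod length bs), ws ! i)}" by simp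
    qed
    hence cs: "closed_steps vs = cycle_edges bs ws \<union> (cycle_edges bs ws)\<inverse>"
      unfolding closed_steps_def hd using steps_interleave[OF bw(1), of "bs ! 0"] bw(2) by simp
    have sub: "cycle_edges bs ws \<subseteq> edges G"
    proof
      fix e assume e: "e \<in> cycle_edges bs ws"
      have "bs ! (Suc i mod length bs) \<in> set bs" for i
        using l by (intro nth_mem mod_less_divisor) linarith
      hence "fst e \<in> set bs" using e by (auto simp: cycle_edges_def)
      hence "fst e \<in> blacks G" using b by blast
      moreover have "e \<in> edges G \<union> (edges G)\<inverse>" using e cs cyc by (auto simp: cycle_in_def)
      ultimately show "e \<in> edges G" using edgeD(2) bipartite
        by (cases e) (auto simp: bipartite_graph_def)
    qed
    have "ctrace vs = cycle_edges bs ws"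
      unfolding ctrace_def cs using sub edges_Int_sym[OF sub order_refl] by auto
    moreover have "simple_cycle G bs ws"
      unfolding simple_cycle_def using sub d l bw(1)[symmetric] by blast
    ultimately show thesis using that by simp
  qed
  show thesis
  proof (cases "hd vs \<in> blacks G")
    case True thus thesis using * cyc that by blast
  next
    case False
    obtain x r where vs: "vs = x # r" using cyc by (cases vs) (auto simp: cycle_in_def)
    then obtain y r' where r: "r = y # r'" using cyc by (cases r) (auto simp: cycle_in_def)
    have "(x, y) \<in> edges G \<union> (edges G)\<inverse>" using cyc vs r by (auto simp: cycle_in_def closed_steps_def)
    hence "y \<in> blacks G" using False vs edgeD by auto
    moreover have "closed_steps (r @ [x]) = closed_steps vs"
      using closed_steps_rotate[of "[x]" y r'] vs r by simp
    moreover from this have "cycle_in (edges G) (r @ [x])" using cyc vs by (auto simp: cycle_in_def)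
    ultimately show thesis using *[of "r @ [x]"] that r by (auto simp: ctrace_def)
  qed
qed

end

section \<open>Splitting a cycle along a chord\<close>

context plane_bgraph
begin

lemma trace_Cons:
  assumes "(u, v) \<in> edges G \<union> (edges G)\<inverse>"
  obtains e where "e \<in> edges G" "{fst e, snd e} = {u, v}" "trace (u # v # r) = insert e (trace (v # r))"
    "edges G \<inter> {(u, v), (v, u)} = {e}"
proof -
  consider "(u, v) \<in> edges G" | "(v, u) \<in> edges G" using assms by auto
  thus thesis
  proof cases
    case 1
    hence "(v, u) \<notin> edges G" by (rule edgeD)
    thus thesis using 1 by (intro that[of "(u, v)"]) (auto simp: trace_def)
  next
    case 2
    hence "(u, v) \<notin> edges G" by (rule edgeD)
    thus thesis using 2 by (intro that[of "(v, u)"]) (auto simp: trace_def)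
  qed
qed

lemma edge_arc:
  assumes e: "e \<in> edges G" and uv: "{fst e, snd e} = {u, v}"
  obtains g where "arc g" "pathstart g = point D u" "pathfinish g = point D v"
    "path_image g = path_image (curve D e)"
proof -
  obtain b w where bw: "e = (b, w)" by (cases e)
  note c = arc_curve[of b w] e[unfolded bw]
  consider "u = b" "v = w" | "u = w" "v = b" using uv bw by (auto simp: doubleton_eq_iff)
  thus thesis
  proof cases
    case 1 thus thesis using c bw by (intro that[of "curve D e"]) auto
  next
    case 2 thus thesis using c bw
      by (intro that[of "reversepath (curve D e)"]) (auto simp: arc_reversepath)
  qed
qed

lemma arc_of_walk:
  assumes "distinct vs" "2 \<le> length vs" "steps vs \<subseteq> edges G \<union> (edges G)\<inverse>"
  shows "\<exists>g. arc g \<and> pathstart g = point D (hd vs) \<and> pathfinish g = point D (last vs) \<and>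
             path_image g = img (trace vs)"
  using assms
proof (induction vs rule: steps.induct)
  case (1 u v r)
  have "(u, v) \<in> edges G \<union> (edges G)\<inverse>" using 1 by auto
  then obtain e where e: "e \<in> edges G" "{fst e, snd e} = {u, v}"
     "trace (u # v # r) = insert e (trace (v # r))" by (rule trace_Cons)
  obtain h where h: "arc h" "pathstart h = point D u" "pathfinish h = point D v"
    "path_image h = path_image (curve D e)" using edge_arc e(1,2) by metis
  show ?case
  proof (cases "r = []")
    case True thus ?thesis using h e by (intro exI[of _ h]) (auto simp: trace_def img_def)
  next
    case False
    then obtain g where g: "arc g" "pathstart g = point D v" "pathfinish g = point D (last (v # r))"
      "path_image g = img (trace (v # r))"
      using 1 by (cases r) auto
    have "path_image h \<inter> path_image g \<subseteq> {point D v}"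
    proof -
      have "u \<notin> ends (trace (v # r))" using ends_trace[of "v # r"] 1 by auto
      hence "e \<notin> trace (v # r)" using e(2) by (auto simp: ends_def)
      hence "img {e} \<inter> img (trace (v # r)) \<subseteq> point D ` (ends {e} \<inter> ends (trace (v # r)))"
        using e by (intro img_meet) (auto simp: trace_def)
      also have "\<dots> \<subseteq> {point D v}"
        using e(2) \<open>u \<notin> ends (trace (v # r))\<close> by (auto simp: ends_def)
      finally show ?thesis using h g by (simp add: img_def)
    qed
    hence "arc (h +++ g)" using h g by (intro arc_join) auto
    thus ?thesis
      using h g e(3) False by (intro exI[of _ "h +++ g"]) (auto simp: path_image_join img_def)
  qed
qed auto

text \<open>A path through the interior of a cycle forms a theta curve with it.  Both cycles through the path enclose
  fewer vertices, since \<open>d\<close> now lies on them, and the edges of the path appear twice in the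
  product of the signs of the two cycles.\<close>

lemma theta_split:
  fixes \<tau> :: "'v \<times> 'v \<Rightarrow> int"
  assumes cyc: "cycle_in F (c # A @ c' # B)" and F: "F \<subseteq> edges G"
    and P: "P \<noteq> []" "distinct P" "set P \<inter> set (c # A @ c' # B) = {}"
      "steps (c # P @ [c']) \<subseteq> F \<union> F\<inverse>"
    and d: "d \<in> set P" "d \<in> enclosed_verts G D (ctrace (c # A @ c' # B))"
    and sq: "\<And>e. e \<in> edges G \<Longrightarrow> \<tau> e * \<tau> e = 1"
  obtains C1 C2 where "cycle_in F C1" "cycle_in F C2"
    "enclosed_verts G D (ctrace C1) \<subset> enclosed_verts G D (ctrace (c # A @ c' # B))"
    "enclosed_verts G D (ctrace C2) \<subset> enclosed_verts G D (ctrace (c # A @ c' # B))"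
    "prod \<tau> (ctrace C1) * prod \<tau> (ctrace C2) = prod \<tau> (ctrace (c # A @ c' # B))"
proof -
  let ?C = "c # A @ c' # B"
  let ?C1 = "c # A @ c' # rev P" and ?C2 = "c' # B @ c # P"
  let ?S1 = "steps (c # A @ [c'])" and ?S2 = "steps (c' # B @ [c])" and ?S3 = "steps (c # P @ [c'])"
  let ?T1 = "trace (c # A @ [c'])" and ?T2 = "trace (c' # B @ [c])" and ?T3 = "trace (c # P @ [c'])"
  have dist: "distinct ?C" and len: "3 \<le> length ?C" and CF: "?S1 \<union> ?S2 \<subseteq> F \<union> F\<inverse>"
    using cyc by (simp_all only: cycle_in_def closed_steps_split)
  have rev: "steps (c' # rev P @ [c]) = ?S3" using steps_rev[of "c # P @ [c']"] by simp
  have cs: "closed_steps ?C = ?S1 \<union> ?S2" "closed_steps ?C1 = ?S1 \<union> ?S3"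
    "closed_steps ?C2 = ?S2 \<union> ?S3"
    by (simp_all only: closed_steps_split rev)
  have cyc1: "cycle_in F ?C1" unfolding cycle_in_def cs(2)
    using dist P CF by (cases P) auto
  have cyc2: "cycle_in F ?C2" unfolding cycle_in_def cs(3)
    using dist P CF by (cases P) auto
  have dj: "?S1 \<inter> ?S2 = {}" "?S1 \<inter> ?S3 = {}" "?S2 \<inter> ?S3 = {}"
  proof -
    have s: "?S2 \<subseteq> set (c' # B @ [c]) \<times> set (c' # B @ [c])" 
      "?S1 \<subseteq> set (c # A @ [c']) \<times> set (c # A @ [c'])" by (rule steps_subset)+
    show "?S1 \<inter> ?S2 = {}"
    proof (cases "A = []")
      case False
      thus ?thesis by (intro steps_disjoint[OF _ _ _ s(1)]) (use dist in auto)
    next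
      case True
      hence "B \<noteq> []" using len by auto
      hence "?S2 \<inter> ?S1 = {}"
        by (intro steps_disjoint[OF _ _ _ s(2)]) (use dist in auto)
      thus ?thesis by auto
    qed
    have "?S3 \<inter> ?S1 = {}"
      by (rule steps_disjoint[OF _ P(1) _ s(2)]) (use dist P(2,3) in auto)
    thus "?S1 \<inter> ?S3 = {}" by auto
    have "?S3 \<inter> ?S2 = {}"
      by (rule steps_disjoint[OF _ P(1) _ s(1)]) (use dist P(2,3) in auto)
    thus "?S2 \<inter> ?S3 = {}" by auto
  qed
  have ct: "ctrace ?C = ?T1 \<union> ?T2" "ctrace ?C1 = ?T1 \<union> ?T3" "ctrace ?C2 = ?T2 \<union> ?T3"
    unfolding ctrace_def trace_def cs by auto
  have djT: "?T1 \<inter> ?T2 = {}" "?T1 \<inter> ?T3 = {}" "?T2 \<inter> ?T3 = {}"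
    using dj by (auto simp: trace_def)
  have prods: "prod \<tau> (ctrace ?C1) * prod \<tau> (ctrace ?C2) = prod \<tau> (ctrace ?C)"
  proof -
    have "prod \<tau> ?T3 * prod \<tau> ?T3 = 1"
      unfolding prod.distrib[symmetric] using sq by (intro prod.neutral) (auto simp: trace_def)
    thus ?thesis
      unfolding ct using djT finite_trace by (simp add: prod.union_disjoint algebra_simps)
  qed
  have E: "?S1 \<subseteq> edges G \<union> (edges G)\<inverse>" "?S2 \<subseteq> edges G \<union> (edges G)\<inverse>"
    "?S3 \<subseteq> edges G \<union> (edges G)\<inverse>"
  proof -
    have *: "F \<union> F\<inverse> \<subseteq> edges G \<union> (edges G)\<inverse>" using F by auto
    show "?S1 \<subseteq> edges G \<union> (edges G)\<inverse>" "?S2 \<subseteq> edges G \<union> (edges G)\<inverse>"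
      using CF * by (meson Un_subset_iff order_trans)+
    show "?S3 \<subseteq> edges G \<union> (edges G)\<inverse>" using P(4) * by (rule order_trans)
  qed
  obtain g1 where g1: "arc g1" "pathstart g1 = point D c" "pathfinish g1 = point D c'"
    "path_image g1 = img ?T1"
    using arc_of_walk[OF _ _ E(1)] dist by auto
  obtain g2' where "arc g2'" "pathstart g2' = point D c'" "pathfinish g2' = point D c"
    "path_image g2' = img ?T2"
    using arc_of_walk[OF _ _ E(2)] dist by auto
  then obtain g2 where g2: "arc g2" "pathstart g2 = point D c" "pathfinish g2 = point D c'"
    "path_image g2 = img ?T2"
    by (metis arc_reversepath path_image_reversepath pathfinish_reversepath pathstart_reversepath)
  obtain g3 where g3: "arc g3" "pathstart g3 = point D c" "pathfinish g3 = point D c'"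
    "path_image g3 = img ?T3"
    using arc_of_walk[OF _ _ E(3)] dist P by auto
  have T: "?T1 \<subseteq> edges G" "?T2 \<subseteq> edges G" "?T3 \<subseteq> edges G" by (auto simp: trace_def)
  have "img ?T1 \<inter> img ?T2 \<subseteq> point D ` {c, c'}"
    using img_meet[OF T(1,2) djT(1)] ends_trace[of "c # A @ [c']"] ends_trace[of "c' # B @ [c]"] dist
    by fastforce
  moreover have "img ?T1 \<inter> img ?T3 \<subseteq> point D ` {c, c'}"
    using img_meet[OF T(1,3) djT(2)] ends_trace[of "c # A @ [c']"] ends_trace[of "c # P @ [c']"] P
    by fastforce
  moreover have "img ?T2 \<inter> img ?T3 \<subseteq> point D ` {c, c'}"
    using img_meet[OF T(2,3) djT(3)] ends_trace[of "c' # B @ [c]"] ends_trace[of "c # P @ [c']"] P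
    by fastforce
  moreover have "point D c \<in> path_image g1" "point D c' \<in> path_image g1"
    "point D c \<in> path_image g2" "point D c' \<in> path_image g2"
    "point D c \<in> path_image g3" "point D c' \<in> path_image g3"
    using g1 g2 g3 by (metis pathstart_in_path_image pathfinish_in_path_image)+
  ultimately have meet: "path_image g1 \<inter> path_image g2 = {point D c, point D c'}"
    "path_image g1 \<inter> path_image g3 = {point D c, point D c'}"
    "path_image g2 \<inter> path_image g3 = {point D c, point D c'}"
    using g1(4) g2(4) g3(4) by auto
  have cyc': "cycle_in (edges G) ?C" "cycle_in (edges G) ?C1" "cycle_in (edges G) ?C2"
    using cyc cyc1 cyc2 F by (auto simp: cycle_in_def)
  have V: "set ?C \<subseteq> verts G" "set ?C1 \<subseteq> verts G" "set ?C2 \<subseteq> verts G"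
    using ends_closed_trace[OF cyc'(1)] ends_closed_trace[OF cyc'(2)] ends_closed_trace[OF cyc'(3)] 
      ends_edges[of "ctrace ?C"]
      ends_edges[of "ctrace ?C1"] ends_edges[of "ctrace ?C2"] by (simp_all add: ctrace_def)
  have "point D c \<noteq> point D c'" using V dist by (subst point_eq_iff) auto
  moreover have "path_image g3 \<inter> inside (path_image g1 \<union> path_image g2) \<noteq> {}"
  proof -
    have "d \<in> ends (ctrace ?C1)" using ends_closed_trace[OF cyc'(2)] d by auto
    hence "d \<in> ends ?T3 \<or> d \<in> ends ?T1" by (auto simp: ct ends_Un)
    moreover have "d \<notin> ends ?T1" using ends_trace[of "c # A @ [c']"] d P by auto
    ultimately have "point D d \<in> path_image g3"
      using g3 point_in_img[OF T(3)] ends_edges[OF T(3)] by blast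
    moreover have "point D d \<in> inside (path_image g1 \<union> path_image g2)"
      using d(2) g1 g2 by (simp add: enclosed_verts_img ct img_Un)
    ultimately show ?thesis by blast
  qed
  ultimately have ins: "inside (path_image g1 \<union> path_image g3) \<union> inside (path_image g2 \<union> path_image g3)
      \<subseteq> inside (path_image g1 \<union> path_image g2)"
    using split_inside_simple_closed_curve[of g1 "point D c" "point D c'" g2 g3] g1 g2 g3 meet
    by (metis (no_types, lifting) Un_upper1 arc_imp_simple_path)
  have sub: "enclosed_verts G D (ctrace ?C1) \<subseteq> enclosed_verts G D (ctrace ?C)"
    "enclosed_verts G D (ctrace ?C2) \<subseteq> enclosed_verts G D (ctrace ?C)"
    using ins g1 g2 g3 by (auto simp: enclosed_verts_img ct img_Un)
  have "d \<notin> enclosed_verts G D (ctrace ?C1)" "d \<notin> enclosed_verts G D (ctrace ?C2)"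
    using enclosed_not_end[of "ctrace ?C1" d] enclosed_not_end[of "ctrace ?C2" d]
      ends_closed_trace[OF cyc'(2)] ends_closed_trace[OF cyc'(3)] d
    by (auto simp: ctrace_def)
  hence "enclosed_verts G D (ctrace ?C1) \<subset> enclosed_verts G D (ctrace ?C)"
    "enclosed_verts G D (ctrace ?C2) \<subset> enclosed_verts G D (ctrace ?C)"
    using sub d(2) by blast+
  thus thesis using that[OF cyc1 cyc2 _ _ prods] by blast
qed

end

section \<open>Cycles of edges that occur in near matchings\<close>

context plane_bgraph
begin

text \<open>Perfect matchings of a compound graph induce matchings of this kind on the copies of the base graph,
  with \<open>X\<close> the set of vertices on the outer face: only these can be matched to stems and leaves.\<close>

definition near_matching :: "'v set \<Rightarrow> ('v \<times> 'v) set \<Rightarrow> bool" where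
  "near_matching X N \<longleftrightarrow> matching N \<and> (\<forall>v\<in>verts G - X. \<exists>e\<in>N. v \<in> {fst e, snd e})"

definition allowed :: "'v set \<Rightarrow> ('v \<times> 'v) set" where
  "allowed X = \<Union>{N. near_matching X N}"

lemma near_matching_subset: "near_matching X N \<Longrightarrow> N \<subseteq> allowed X"
  by (auto simp: allowed_def)

lemma allowed_subset: "allowed X \<subseteq> edges G"
  by (auto simp: allowed_def near_matching_def matching_def)

lemma near_matching_partner:
  assumes "near_matching X N" "v \<in> verts G" "v \<notin> X"
  obtains e u where "e \<in> N" "{fst e, snd e} = {v, u}" "(v, u) \<in> allowed X \<union> (allowed X)\<inverse>"
proof -
  obtain e where e: "e \<in> N" "v \<in> {fst e, snd e}"
    using assms unfolding near_matching_def by blast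
  obtain x y where xy: "e = (x, y)" by (cases e)
  have "(x, y) \<in> allowed X" using e xy near_matching_subset[OF assms(1)] by auto
  thus thesis using e xy by (cases "v = x") (auto intro: that[of e y] that[of e x])
qed

lemma even_card_if_near_matched:
  assumes N: "near_matching X N" and Y: "Y \<subseteq> verts G"
    and cl: "\<And>v. v \<in> Y \<Longrightarrow> \<exists>e\<in>N. \<exists>u\<in>Y. {fst e, snd e} = {v, u}"
  shows "even (card Y)"
proof (rule even_card_if_matched[OF _ Y])
  show "matching N" using N by (simp add: near_matching_def)
  fix v assume v: "v \<in> Y"
  then obtain e u where eu: "e \<in> N" "u \<in> Y" "{fst e, snd e} = {v, u}" using cl by blast
  have "fst e \<in> {v, u}" "snd e \<in> {v, u}" "v \<in> {fst e, snd e}" using eu(3) by blast+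
  thus "\<exists>e\<in>N. v \<in> {fst e, snd e} \<and> fst e \<in> Y \<and> snd e \<in> Y" using eu v by (intro bexI[of _ e]) auto
qed

lemma enclosed_step':
  assumes F: "F \<subseteq> edges G" and uv: "(u, v) \<in> edges G \<union> (edges G)\<inverse>"
    and u: "u \<in> enclosed_verts G D F" 
  shows "v \<in> enclosed_verts G D F \<or> v \<in> ends F"
  using uv enclosed_step[OF F, of "(u, v)" u v] enclosed_step[OF F, of "(v, u)" u v] u by auto

text \<open>Suppose no allowed edge joined the interior \<open>W\<close> of the cycle to the cycle.  A near matching would then match
  \<open>W\<close> within itself, contrary to its odd size.  So some component \<open>K\<close> of the allowed edges within \<open>W\<close> is joined
  to a vertex \<open>c\<close> of the cycle.  If \<open>c\<close> were the only such vertex, \<open>K\<close> would have odd size, because some near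
  matching uses the edge from \<open>c\<close> to \<open>K\<close>, and even size, because some near matching uses a cycle edge at \<open>c\<close>.
  Hence \<open>K\<close> is joined to a second vertex of the cycle, and a path through \<open>K\<close> is the chord.\<close>

lemma odd_cycle_has_chord:
  assumes cyc: "cycle_in (allowed X) vs" 
    and free: "enclosed_verts G D (ctrace vs) \<inter> X = {}"
    and odd: "odd (card (enclosed_verts G D (ctrace vs)))"
  obtains c c' P where "c \<in> set vs" "c' \<in> set vs" "c \<noteq> c'" "P \<noteq> []" "distinct P"
    "set P \<subseteq> enclosed_verts G D (ctrace vs)"
    "steps (c # P @ [c']) \<subseteq> allowed X \<union> (allowed X)\<inverse>"
proof -
  define W where "W = enclosed_verts G D (ctrace vs)"
  define A where "A = allowed X \<union> (allowed X)\<inverse>"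
  have CE: "ctrace vs \<subseteq> edges G" by (auto simp: ctrace_def)
  have cycG: "cycle_in (edges G) vs" using cyc allowed_subset[of X] by (auto simp: cycle_in_def)
  note ends = ends_closed_trace[OF cycG]
  have CA: "ctrace vs \<subseteq> allowed X"
    unfolding ctrace_def using cyc by (intro edges_Int_sym allowed_subset) (auto simp: cycle_in_def)
  have AE: "A \<subseteq> edges G \<union> (edges G)\<inverse>" using allowed_subset[of X] by (auto simp: A_def)
  have symA: "(y, x) \<in> A" if "(x, y) \<in> A" for x y using that by (auto simp: A_def)
  have WV: "W \<subseteq> verts G" by (auto simp: W_def enclosed_verts_def)
  have finW: "finite W" using WV finite_verts finite_subset by blast
  have Wvs: "W \<inter> set vs = {}" using enclosed_not_end[OF CE] ends by (auto simp: W_def)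
  have nbr: "u \<in> W \<or> u \<in> set vs" if "v \<in> W" "(v, u) \<in> A" for u v
    using enclosed_step'[OF CE, of v u] that AE ends by (auto simp: W_def)
  have WX: "v \<in> verts G \<and> v \<notin> X" if "v \<in> W" for v using that free WV by (auto simp: W_def)
  have "\<exists>d\<in>W. \<exists>c\<in>set vs. (d, c) \<in> A"
  proof (rule ccontr)
    assume no: "\<not> (\<exists>d\<in>W. \<exists>c\<in>set vs. (d, c) \<in> A)"
    have "set vs \<noteq> {}" using cyc by (auto simp: cycle_in_def)
    hence "ctrace vs \<noteq> {}" using ends by (auto simp: ends_def)
    then obtain N where N: "near_matching X N" using CA by (auto simp: allowed_def)
    have "even (card W)"
    proof (rule even_card_if_near_matched[OF N WV])
      fix v assume v: "v \<in> W"
      obtain e u where "e \<in> N" "{fst e, snd e} = {v, u}" "(v, u) \<in> A"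
        using near_matching_partner[OF N] WX[OF v] unfolding A_def by metis
      thus "\<exists>e\<in>N. \<exists>u\<in>W. {fst e, snd e} = {v, u}" using no nbr[OF v] v by blast
    qed
    thus False using odd by (simp add: W_def)
  qed
  then obtain d c where dc: "d \<in> W" "c \<in> set vs" "(d, c) \<in> A" by blast
  define R where "R = A \<inter> W \<times> W"
  define K where "K = R\<^sup>* `` {d}"
  have dK: "d \<in> K" by (simp add: K_def)
  have KW: "K \<subseteq> W"
  proof
    fix x assume "x \<in> K"
    hence "(d, x) \<in> R\<^sup>*" by (simp add: K_def)
    thus "x \<in> W" by (induction rule: rtrancl_induct) (use dc in \<open>auto simp: R_def\<close>)
  qed
  have Kstep: "u \<in> K" if "v \<in> K" "u \<in> W" "(v, u) \<in> A" for u v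
    using that KW by (auto simp: K_def R_def intro: rtrancl_into_rtrancl)
  have finK: "finite K" using KW finW finite_subset by blast
  have "\<exists>d'\<in>K. \<exists>c'\<in>set vs. c' \<noteq> c \<and> (d', c') \<in> A"
  proof (rule ccontr)
    assume no: "\<not> (\<exists>d'\<in>K. \<exists>c'\<in>set vs. c' \<noteq> c \<and> (d', c') \<in> A)"
    have nbrK: "u \<in> K \<or> u = c" if "v \<in> K" "(v, u) \<in> A" for u v
      using no nbr[of v u] Kstep[of v u] that KW by blast
    have cK: "c \<notin> K" using KW Wvs dc(2) by blast
    \<comment> \<open>The near matching that uses the edge from \<open>c\<close> to \<open>d\<close> matches \<open>insert c K\<close> within itself.\<close>
    have "even (card (insert c K))"
    proof -
      have "\<exists>e\<in>allowed X. {fst e, snd e} = {c, d}"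
        using dc(3) by (force simp: A_def)
      then obtain e N where e: "e \<in> N" "near_matching X N" "{fst e, snd e} = {c, d}"
        by (auto simp: allowed_def)
      show ?thesis
      proof (rule even_card_if_near_matched[OF e(2)])
        show "insert c K \<subseteq> verts G"
          using KW WV dc(2) ends ends_edges[OF CE] by auto
        fix v assume v: "v \<in> insert c K"
        show "\<exists>e\<in>N. \<exists>u\<in>insert c K. {fst e, snd e} = {v, u}"
        proof (cases "v = c")
          case True thus ?thesis using e dK by blast
        next
          case False
          hence vK: "v \<in> K" using v by simp
          obtain e u where "e \<in> N" "{fst e, snd e} = {v, u}" "(v, u) \<in> A"
            using near_matching_partner[OF e(2)] WX vK KW unfolding A_def by (metis subsetD)
          thus ?thesis using nbrK[OF vK] by blast
        qed
      qed
    qed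
    hence "odd (card K)" using finK cK by simp
    moreover have "even (card K)"
    proof -
      \<comment> \<open>A near matching that uses a cycle edge at \<open>c\<close> has to match \<open>K\<close> within itself.\<close>
      obtain f where f: "f \<in> ctrace vs" "c \<in> {fst f, snd f}"
        using dc(2) unfolding ends[symmetric] ends_def by blast
      then obtain N where N: "f \<in> N" "near_matching X N"
        using CA by (auto simp: allowed_def)
      show ?thesis
      proof (rule even_card_if_near_matched[OF N(2)])
        show "K \<subseteq> verts G" using KW WV by auto
        fix v assume v: "v \<in> K"
        obtain e u where eu: "e \<in> N" "{fst e, snd e} = {v, u}" "(v, u) \<in> A"
          using near_matching_partner[OF N(2)] WX v KW unfolding A_def by (metis subsetD)
        have "u \<noteq> c"
        proof
          assume "u = c"
          hence "c \<in> {fst e, snd e} \<inter> {fst f, snd f}" using eu f by simp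
          hence "e = f" using N eu(1) unfolding near_matching_def matching_def by blast
          hence "v \<in> ends (ctrace vs)" using eu(2) f(1) by (force simp: ends_def)
          thus False using v KW Wvs ends by blast
        qed
        thus "\<exists>e\<in>N. \<exists>u\<in>K. {fst e, snd e} = {v, u}" using nbrK[OF v eu(3)] eu by blast
      qed
    qed
    ultimately show False by simp
  qed
  then obtain d' c' where dc': "d' \<in> K" "c' \<in> set vs" "c' \<noteq> c" "(d', c') \<in> A" by blast
  have "(d, d') \<in> R\<^sup>*" using dc'(1) by (simp add: K_def)
  moreover have "sym R" using symA by (auto simp: R_def sym_def)
  ultimately obtain P where P: "P \<noteq> []" "hd P = d" "last P = d'" "distinct P" "steps P \<subseteq> R"
    "set P \<subseteq> K" unfolding K_def by (rule rtrancl_obtain_path)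
  obtain P1 where P1: "P = d # P1" using P by (cases P) auto
  obtain P2 where P2: "P = P2 @ [d']" using P by (metis append_butlast_last_id)
  have "steps (c # P @ [c']) = {(c, d), (d, c)} \<union> steps (P @ [c'])" using P1 by simp
  also have "steps (P @ [c']) = steps P \<union> {(d', c'), (c', d')}"
    unfolding P2 using steps_append[of P2 d' "[c']"] by simp
  finally have "steps (c # P @ [c']) \<subseteq> A" using P(5) dc dc' symA by (auto simp: R_def)
  thus thesis using that[of c c' P] dc dc' P KW unfolding A_def W_def by auto
qed

text \<open>Induction on the number of enclosed vertices: if it is odd, a chord of allowed edges splits
  the cycle into two that enclose fewer vertices.\<close>

lemma allowed_cycle_balanced:
  fixes \<tau> :: "'v \<times> 'v \<Rightarrow> int"
  assumes sq: "\<And>e. e \<in> edges G \<Longrightarrow> \<tau> e * \<tau> e = 1"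
    and even: "\<And>vs. cycle_in (edges G) vs \<Longrightarrow>
        even (card (enclosed_verts G D (ctrace vs))) \<Longrightarrow> prod \<tau> (ctrace vs) = 1"
    and free: "\<And>F. F \<subseteq> edges G \<Longrightarrow> enclosed_verts G D F \<inter> X = {}"
    and cyc: "cycle_in (allowed X) vs"
  shows "prod \<tau> (ctrace vs) = 1"
  using cyc
proof (induction "card (enclosed_verts G D (ctrace vs))" arbitrary: vs rule: less_induct)
  case less
  have cycG: "cycle_in (edges G) vs" using less.prems allowed_subset[of X] by (auto simp: cycle_in_def)
  show ?case
  proof (cases "even (card (enclosed_verts G D (ctrace vs)))")
    case True thus ?thesis by (rule even[OF cycG])
  next
    case False
    have CE: "ctrace vs \<subseteq> edges G" by (auto simp: ctrace_def)
    obtain c c' P where P: "c \<in> set vs" "c' \<in> set vs" "c \<noteq> c'" "P \<noteq> []" "distinct P"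
      "set P \<subseteq> enclosed_verts G D (ctrace vs)"
      "steps (c # P @ [c']) \<subseteq> allowed X \<union> (allowed X)\<inverse>"
      using odd_cycle_has_chord[OF less.prems free[OF CE] False] by metis
    obtain A B where AB: "closed_steps (c # A @ c' # B) = closed_steps vs"
      "distinct (c # A @ c' # B)" "set (c # A @ c' # B) = set vs"
      "length (c # A @ c' # B) = length vs"
      using closed_steps_rotate_to[OF _ P(1-3)] less.prems by (auto simp: cycle_in_def)
    let ?C = "c # A @ c' # B"
    have ct: "ctrace ?C = ctrace vs" unfolding ctrace_def AB(1) ..
    have cyc: "cycle_in (allowed X) ?C"
      using less.prems unfolding cycle_in_def AB(1,4) using AB(2) by blast
    have dj: "set P \<inter> set ?C = {}"
      unfolding AB(3) using P(6) enclosed_not_end[OF CE] ends_closed_trace[OF cycG] by blast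
    have h: "hd P \<in> set P" "hd P \<in> enclosed_verts G D (ctrace ?C)"
      using P ct by auto
    obtain C1 C2 where C: "cycle_in (allowed X) C1" "cycle_in (allowed X) C2"
      "enclosed_verts G D (ctrace C1) \<subset> enclosed_verts G D (ctrace vs)"
      "enclosed_verts G D (ctrace C2) \<subset> enclosed_verts G D (ctrace vs)"
      "prod \<tau> (ctrace C1) * prod \<tau> (ctrace C2) = prod \<tau> (ctrace vs)"
    proof (rule theta_split[OF cyc allowed_subset P(4,5) dj P(7) h, unfolded ct])
      show "\<tau> e * \<tau> e = 1" if "e \<in> edges G" for e using sq that .
    qed
    have fin: "finite (enclosed_verts G D (ctrace vs))"
      using finite_verts by (auto simp: enclosed_verts_def)
    have "prod \<tau> (ctrace C1) = 1" "prod \<tau> (ctrace C2) = 1"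
      by (rule less.hyps[OF psubset_card_mono[OF fin C(3)] C(1)],
          rule less.hyps[OF psubset_card_mono[OF fin C(4)] C(2)])
    thus ?thesis using C(5) by simp
  qed
qed

section \<open>Sign functions agree on allowed edges up to a gauge\<close>

lemma prod_trace_gauge:
  fixes \<tau> :: "'v \<times> 'v \<Rightarrow> int"
  assumes "distinct P" "P \<noteq> []" "steps P \<subseteq> F \<union> F\<inverse>" "F \<subseteq> edges G"
    and \<alpha>: "\<And>v. \<alpha> v \<in> {1, -1 :: int}" "\<And>b w. (b, w) \<in> F \<Longrightarrow> \<tau> (b, w) = \<alpha> b * \<alpha> w"
  shows "prod \<tau> (trace P) = \<alpha> (hd P) * \<alpha> (last P)"
  using assms(1-3)
proof (induction P rule: steps.induct)
  case (1 u v r)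
  have uv: "(u, v) \<in> F \<union> F\<inverse>" using 1 by auto
  hence "(u, v) \<in> edges G \<union> (edges G)\<inverse>" using assms(4) by auto
  then obtain e where e: "e \<in> edges G" "{fst e, snd e} = {u, v}"
     "trace (u # v # r) = insert e (trace (v # r))" "edges G \<inter> {(u, v), (v, u)} = {e}" by (rule trace_Cons)
  have "u \<notin> ends (trace (v # r))" using ends_trace[of "v # r"] 1 by auto
  hence "e \<notin> trace (v # r)" using e(2) by (auto simp: ends_def)
  moreover have "\<tau> e = \<alpha> u * \<alpha> v"
  proof -
    have "edges G \<inter> {(u, v), (v, u)} \<subseteq> F" using uv assms(4) by (intro edges_Int_sym) auto
    hence "e \<in> F" "e = (u, v) \<or> e = (v, u)" using e(4) by auto
    thus ?thesis using \<alpha>(2) by (auto simp: mult.commute)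
  qed
  moreover have "\<alpha> v * \<alpha> v = 1" using \<alpha>(1)[of v] by auto
  moreover have "prod \<tau> (trace (v # r)) = \<alpha> v * \<alpha> (last (v # r))" using 1 by auto
  ultimately have "prod \<tau> (trace (u # v # r)) = \<alpha> u * (\<alpha> v * \<alpha> v) * \<alpha> (last (v # r))"
    unfolding e(3) using finite_trace by (simp add: mult.assoc)
  thus ?case using \<open>\<alpha> v * \<alpha> v = 1\<close> by simp
next
  case (2 u)
  have "\<alpha> u * \<alpha> u = 1" using \<alpha>(1)[of u] by auto
  thus ?case by (simp add: trace_def)
qed simp

text \<open>The edges are added one at a time.  If an edge closes a path of the earlier edges to a cycle, the condition
  on that cycle shows that the gauge fits it already; otherwise it joins two components, and the gauge
  can be flipped on one of them.\<close>

lemma balanced_imp_gauge: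
  fixes \<tau> :: "'v \<times> 'v \<Rightarrow> int"
  assumes F: "F \<subseteq> edges G"
    and val: "\<And>e. e \<in> F \<Longrightarrow> \<tau> e \<in> {1, -1}"
    and bal: "\<And>vs. cycle_in F vs \<Longrightarrow> prod \<tau> (ctrace vs) = 1"
  shows "\<exists>\<alpha>. (\<forall>v. \<alpha> v \<in> {1, -1 :: int}) \<and> (\<forall>b w. (b, w) \<in> F \<longrightarrow> \<tau> (b, w) = \<alpha> b * \<alpha> w)"
proof -
  have "finite F" using F finite_edges finite_subset by blast
  thus ?thesis using assms
  proof (induction F rule: finite_induct)
    case empty
    show ?case by (rule exI[of _ "\<lambda>_. 1"]) auto
  next
    case (insert e F)
    obtain b w where e: "e = (b, w)" by (cases e)
    have bw: "(b, w) \<in> edges G" using insert.prems e by auto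
    have F: "F \<subseteq> edges G" using insert.prems by auto
    have "\<exists>\<alpha>. (\<forall>v. \<alpha> v \<in> {1, -1 :: int}) \<and> (\<forall>b w. (b, w) \<in> F \<longrightarrow> \<tau> (b, w) = \<alpha> b * \<alpha> w)"
    proof (rule insert.IH[OF F])
      show "\<tau> e \<in> {1, -1}" if "e \<in> F" for e using insert.prems(2) that by blast
      show "prod \<tau> (ctrace vs) = 1" if "cycle_in F vs" for vs
        using that by (intro insert.prems(3)) (auto simp: cycle_in_def)
    qed
    then obtain \<alpha> where \<alpha>: "\<And>v. \<alpha> v \<in> {1, -1 :: int}" "\<And>b w. (b, w) \<in> F \<Longrightarrow> \<tau> (b, w) = \<alpha> b * \<alpha> w"
      by blast
    have sq: "\<alpha> v * \<alpha> v = 1" for v using \<alpha>(1)[of v] by auto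
    define R where "R = F \<union> F\<inverse>"
    have symR: "sym R" by (auto simp: R_def sym_def)
    show ?case
    proof (cases "(b, w) \<in> R\<^sup>*")
      case True
      then obtain P where P: "P \<noteq> []" "hd P = b" "last P = w" "distinct P" "steps P \<subseteq> R"
        using symR by (rule rtrancl_obtain_path)
      obtain P' where P': "P = b # P'" using P by (cases P) auto
      have "P' \<noteq> []" using P P' edgeD[OF bw] by auto
      then obtain x P'' where P'': "P' = x # P''" by (cases P') auto
      have "P'' \<noteq> []"
      proof
        assume "P'' = []"
        hence "(b, w) \<in> R" using P P' P'' by auto
        thus False using insert.hyps e edgeD[OF bw] F by (auto simp: R_def)
      qed
      hence len: "3 \<le> length P" using P' P'' by (cases P'') auto
      have cs: "closed_steps P = {(b, w), (w, b)} \<union> steps P"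
      proof -
        obtain Q where Q: "P = Q @ [w]" using P by (metis append_butlast_last_id)
        have "closed_steps P = steps (Q @ w # [b])" by (simp add: closed_steps_def P(2)) (simp add: Q)
        also have "\<dots> = steps P \<union> {(w, b), (b, w)}" unfolding Q by (subst steps_append) simp
        finally show ?thesis by auto
      qed
      have tr: "trace P \<subseteq> F" using trace_subset[OF F] P(5) by (simp add: R_def)
      have "cycle_in (insert e F) P"
        using P len e unfolding cycle_in_def cs R_def by auto
      hence "prod \<tau> (ctrace P) = 1" by (rule insert.prems)
      moreover have "ctrace P = insert e (trace P)"
        using bw edgeD(6)[OF bw] e unfolding ctrace_def cs trace_def by auto
      moreover have "e \<notin> trace P" using tr insert.hyps by auto
      moreover have "prod \<tau> (trace P) = \<alpha> b * \<alpha> w"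
      proof -
        have "steps P \<subseteq> F \<union> F\<inverse>" using P(5) by (simp add: R_def)
        hence "prod \<tau> (trace P) = \<alpha> (hd P) * \<alpha> (last P)"
          using \<alpha> by (intro prod_trace_gauge[OF P(4,1) _ F])
        thus ?thesis using P(2,3) by simp
      qed
      ultimately have "\<tau> e * (\<alpha> b * \<alpha> w) = 1" using finite_trace by simp
      hence "\<tau> e = \<alpha> b * \<alpha> w"
        using \<alpha>(1)[of b] \<alpha>(1)[of w] by auto
      thus ?thesis using \<alpha> e by (intro exI[of _ \<alpha>]) auto
    next
      case False
      define K where "K = R\<^sup>* `` {w}"
      define s where "s = \<tau> e * \<alpha> b * \<alpha> w"
      define \<alpha>' where "\<alpha>' = (\<lambda>v. if v \<in> K then s * \<alpha> v else \<alpha> v)"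
      have s: "s \<in> {1, -1}" using \<alpha>(1)[of b] \<alpha>(1)[of w] insert.prems(2)[of e] by (auto simp: s_def)
      have "(w, b) \<notin> R\<^sup>*"
      proof
        assume "(w, b) \<in> R\<^sup>*"
        hence "(b, w) \<in> R\<^sup>*" using sym_rtrancl[OF symR] by (auto simp: sym_def)
        thus False using False by simp
      qed
      hence bK: "b \<notin> K" by (auto simp: K_def)
      have wK: "w \<in> K" by (auto simp: K_def)
      have K: "x \<in> K \<longleftrightarrow> y \<in> K" if "(x, y) \<in> F" for x y
      proof -
        have "(x, y) \<in> R" "(y, x) \<in> R" using that by (auto simp: R_def)
        thus ?thesis by (auto simp: K_def intro: rtrancl_into_rtrancl)
      qed
      have "\<alpha>' v \<in> {1, -1}" for v using s \<alpha>(1)[of v] by (auto simp: \<alpha>'_def)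
      moreover have "\<tau> (x, y) = \<alpha>' x * \<alpha>' y" if "(x, y) \<in> F" for x y
        using \<alpha>(2)[OF that] K[OF that] s by (auto simp: \<alpha>'_def)
      moreover have "\<tau> (b, w) = \<alpha>' b * \<alpha>' w"
        using bK wK sq[of b] sq[of w] by (simp add: \<alpha>'_def s_def e algebra_simps)
      ultimately show ?thesis using e by (intro exI[of _ \<alpha>']) auto
    qed
  qed
qed

text \<open>The region enclosed by a set of edges is open and disjoint from the outer face, hence also from the
  boundary of the outer face.\<close>

lemma enclosed_not_outer:
  assumes F: "F \<subseteq> edges G"
  shows "enclosed_verts G D F \<inter> {v. on_outer_face G D v} = {}"
proof (rule equals0I)
  fix v assume v: "v \<in> enclosed_verts G D F \<inter> {v. on_outer_face G D v}"
  have "img F \<subseteq> drawn_set G D" using F by (auto simp: img_def drawn_set_def)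
  hence "outside (drawn_set G D) \<inter> inside (img F) = {}"
    using outside_mono inside_Int_outside by blast
  hence "inside (img F) \<inter> closure (outside (drawn_set G D)) = {}"
    using open_Int_closure_eq_empty[OF open_inside[OF closed_img[OF F]]] by blast
  moreover have "point D v \<in> closure (outside (drawn_set G D))"
    using v by (auto simp: on_outer_face_def frontier_def)
  ultimately show False using v by (auto simp: enclosed_verts_img)
qed

text \<open>The quotient of the sign functions has product \<open>1\<close> around cycles that enclose an even number of vertices,
  because both prescribe the same sign there; allowed cycles then follow from
  \<open>allowed_cycle_balanced\<close>.\<close>

lemma sign_functions_differ_by_gauge:
  assumes \<sigma>: "sign_function G D \<sigma>" and \<sigma>': "sign_function G D \<sigma>'"
  obtains \<alpha> where "\<And>v. \<alpha> v \<in> {1, -1 :: int}"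
    "\<And>b w. (b, w) \<in> allowed {v. on_outer_face G D v} \<Longrightarrow> \<sigma> (b, w) * \<sigma>' (b, w) = \<alpha> b * \<alpha> w"
proof -
  define \<tau> where "\<tau> = (\<lambda>e. \<sigma> e * \<sigma>' e)"
  let ?A = "allowed {v. on_outer_face G D v}"
  have val: "\<sigma> e \<in> {1, -1}" "\<sigma>' e \<in> {1, -1}" if "e \<in> edges G" for e
    using \<sigma> \<sigma>' that unfolding sign_function_def by blast+
  have sq: "\<tau> e * \<tau> e = 1" if "e \<in> edges G" for e
    using val[OF that] by (auto simp: \<tau>_def)
  have ev: "prod \<tau> (ctrace vs) = 1"
    if cyc: "cycle_in (edges G) vs" and even: "even (card (enclosed_verts G D (ctrace vs)))" for vs
  proof -
    obtain bs ws where bw: "simple_cycle G bs ws" "cycle_edges bs ws = ctrace vs"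
      using cycle_in_simple_cycle[OF cyc] by blast
    have "prod \<sigma> (ctrace vs) = (-1) ^ (length bs - 1)" "prod \<sigma>' (ctrace vs) = (-1) ^ (length bs - 1)"
      using \<sigma> \<sigma>' bw even unfolding sign_function_def by metis+
    thus ?thesis by (simp add: \<tau>_def prod.distrib power_add[symmetric])
  qed
  have bal: "prod \<tau> (ctrace vs) = 1" if "cycle_in ?A vs" for vs
    using sq ev enclosed_not_outer that by (rule allowed_cycle_balanced)
  have "\<tau> e \<in> {1, -1}" if "e \<in> ?A" for e
  proof -
    have "e \<in> edges G" using that allowed_subset by blast
    from val[OF this] show ?thesis by (auto simp: \<tau>_def)
  qed
  from balanced_imp_gauge[OF allowed_subset this bal]
  obtain \<alpha> where "\<forall>v. \<alpha> v \<in> {1, -1 :: int}" "\<forall>b w. (b, w) \<in> ?A \<longrightarrow> \<tau> (b, w) = \<alpha> b * \<alpha> w"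
    by blast
  thus thesis using that[of \<alpha>] by (auto simp: \<tau>_def)
qed

end

section \<open>Perfect matchings as permutations, and the theorem of Kasteleyn\<close>

lemma sign_cycle_of_list:
  "distinct L \<Longrightarrow> sign (cycle_of_list L) = (-1) ^ (length L - 1)"
proof (induction L rule: cycle_of_list.induct)
  case (1 i j cs)
  have "sign (cycle_of_list (i # j # cs)) = sign (Transposition.transpose i j) * sign (cycle_of_list (j # cs))"
    unfolding cycle_of_list.simps(1)
    by (rule sign_compose[OF permutation_swap_id permutation_of_cycle])
  thus ?case using 1 by (simp add: sign_swap_id del: cycle_of_list.simps)
qed auto

text \<open>With \<open>eb\<close> and \<open>ew\<close> enumerating the black and the white vertices, these are the permutations that
  contribute to the determinant; they correspond to the perfect matchings.\<close>

definition edge_perms :: "'v bgraph \<Rightarrow> nat \<Rightarrow> (nat \<Rightarrow> 'v) \<Rightarrow> (nat \<Rightarrow> 'v) \<Rightarrow> (nat \<Rightarrow> nat) set" where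
  "edge_perms G n eb ew = {p. p permutes {0..<n} \<and> (\<forall>i<n. (eb i, ew (p i)) \<in> edges G)}"

definition perm_matching :: "nat \<Rightarrow> (nat \<Rightarrow> 'v) \<Rightarrow> (nat \<Rightarrow> 'v) \<Rightarrow> (nat \<Rightarrow> nat) \<Rightarrow> ('v \<times> 'v) set" where
  "perm_matching n eb ew p = (\<lambda>i. (eb i, ew (p i))) ` {0..<n}"

lemma inj_on_perm_edge:
  assumes "bij_betw eb {0..<n} B" shows "inj_on (\<lambda>i. (eb i, f i)) {0..<n}"
  using assms by (auto simp: bij_betw_def inj_on_def)

lemma perfect_perm_matching:
  assumes G: "bipartite_graph G" and eb: "bij_betw eb {0..<n} (blacks G)"
    and ew: "bij_betw ew {0..<n} (whites G)" and p: "p \<in> edge_perms G n eb ew"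
  shows "perfect_matching G (perm_matching n eb ew p)"
  unfolding perfect_matching_def
proof (intro conjI ballI)
  let ?M = "perm_matching n eb ew p"
  have pp: "p permutes {0..<n}" using p by (simp add: edge_perms_def)
  have ewp: "bij_betw (\<lambda>i. ew (p i)) {0..<n} (whites G)"
    using bij_betw_trans[OF permutes_imp_bij[OF pp] ew] by (simp add: comp_def)
  show "?M \<subseteq> edges G" using p by (auto simp: edge_perms_def perm_matching_def)
  have disj: "blacks G \<inter> whites G = {}" using G by (simp add: bipartite_graph_def)
  have eB: "eb i \<in> blacks G" "ew (p i) \<in> whites G" if "i < n" for i
    using that eb ewp by (auto simp: bij_betw_def)
  fix v assume "v \<in> verts G"
  then consider "v \<in> blacks G" | "v \<in> whites G" by (auto simp: verts_def)
  thus "\<exists>!e. e \<in> ?M \<and> (v = fst e \<or> v = snd e)"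
  proof cases
    case 1
    then obtain i where i: "i < n" "v = eb i"
      using eb by (metis atLeastLessThan_iff bij_betw_iff_bijections)
    show ?thesis
    proof (intro ex1I[of _ "(eb i, ew (p i))"])
      fix e assume e: "e \<in> ?M \<and> (v = fst e \<or> v = snd e)"
      then obtain j where j: "j < n" "e = (eb j, ew (p j))" by (auto simp: perm_matching_def)
      hence "v = eb j" using e eB[OF j(1)] 1 disj by auto
      hence "j = i" using i j eb by (auto simp: bij_betw_def inj_on_def)
      thus "e = (eb i, ew (p i))" using j by simp
    qed (use i in \<open>auto simp: perm_matching_def\<close>)
  next
    case 2
    then obtain i where i: "i < n" "v = ew (p i)"
      using ewp by (metis atLeastLessThan_iff bij_betw_iff_bijections)
    show ?thesis
    proof (intro ex1I[of _ "(eb i, ew (p i))"])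
      fix e assume e: "e \<in> ?M \<and> (v = fst e \<or> v = snd e)"
      then obtain j where j: "j < n" "e = (eb j, ew (p j))" by (auto simp: perm_matching_def)
      hence "v = ew (p j)" using e eB[OF j(1)] 2 disj by auto
      hence "j = i" using i j ewp by (auto simp: bij_betw_def inj_on_def)
      thus "e = (eb i, ew (p i))" using j by simp
    qed (use i in \<open>auto simp: perm_matching_def\<close>)
  qed
qed

lemma perfect_matching_eq_perm_matching:
  assumes G: "bipartite_graph G" and eb: "bij_betw eb {0..<n} (blacks G)"
    and ew: "bij_betw ew {0..<n} (whites G)" and M: "perfect_matching G M"
  shows "\<exists>p\<in>edge_perms G n eb ew. M = perm_matching n eb ew p"
proof -
  have disj: "blacks G \<inter> whites G = {}" and EG: "edges G \<subseteq> blacks G \<times> whites G"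
    using G by (simp_all add: bipartite_graph_def)
  have ME: "M \<subseteq> edges G" and cov: "\<And>v. v \<in> verts G \<Longrightarrow> \<exists>!e. e \<in> M \<and> (v = fst e \<or> v = snd e)"
    using M by (auto simp: perfect_matching_def)
  have uniq: "e = f" if "e \<in> M" "f \<in> M" "v \<in> verts G" "v = fst e \<or> v = snd e" "v = fst f \<or> v = snd f"
    for e f v
    using cov[OF that(3)] that by blast
  have BW: "b \<in> blacks G" "w \<in> whites G" if "(b, w) \<in> M" for b w using that ME EG by auto
  have eB: "eb i \<in> blacks G" "ew i \<in> whites G" if "i < n" for i
    using that eb ew by (auto simp: bij_betw_def)
  have "\<exists>j<n. (eb i, ew j) \<in> M" if i: "i < n" for i
  proof -
    obtain e where e: "e \<in> M" "eb i = fst e \<or> eb i = snd e"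
      using cov[of "eb i"] eB[OF i] by (auto simp: verts_def)
    obtain b w where bw: "e = (b, w)" by (cases e)
    have "b = eb i" "w \<in> whites G" using e bw BW[of b w] eB[OF i] disj by auto
    moreover from this obtain j where "j < n" "w = ew j"
      using ew by (metis atLeastLessThan_iff bij_betw_iff_bijections)
    ultimately show ?thesis using e bw by auto
  qed
  then obtain f where f: "\<And>i. i < n \<Longrightarrow> f i < n \<and> (eb i, ew (f i)) \<in> M" by metis
  define p where "p = (\<lambda>i. if i < n then f i else i)"
  have "inj_on p {0..<n}"
  proof (rule inj_onI)
    fix i j assume ij: "i \<in> {0..<n}" "j \<in> {0..<n}" "p i = p j"
    hence m: "(eb i, ew (f i)) \<in> M" "(eb j, ew (f i)) \<in> M" using f[of i] f[of j] by (auto simp: p_def)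
    moreover have "ew (f i) \<in> verts G" using f[of i] ij eB by (auto simp: verts_def)
    ultimately have "(eb i, ew (f i)) = (eb j, ew (f i))" by (intro uniq) auto
    thus "i = j" using ij eb by (auto simp: bij_betw_def inj_on_def)
  qed
  moreover have "p ` {0..<n} \<subseteq> {0..<n}" using f by (auto simp: p_def)
  ultimately have "bij_betw p {0..<n} {0..<n}"
    by (simp add: bij_betw_def endo_inj_surj)
  hence pp: "p permutes {0..<n}" by (intro bij_imp_permutes) (auto simp: p_def)
  have "p \<in> edge_perms G n eb ew" using pp f ME by (auto simp: edge_perms_def p_def)
  moreover have "M = perm_matching n eb ew p"
  proof
    show "perm_matching n eb ew p \<subseteq> M" using f by (auto simp: perm_matching_def p_def)
    show "M \<subseteq> perm_matching n eb ew p"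
    proof
      fix e assume e: "e \<in> M"
      obtain b w where bw: "e = (b, w)" by (cases e)
      obtain i where i: "i < n" "b = eb i"
        using eb BW[of b w] e bw by (metis atLeastLessThan_iff bij_betw_iff_bijections)
      have "(eb i, ew (f i)) \<in> M" using f i by simp
      moreover have "eb i \<in> verts G" using eB[OF i(1)] by (simp add: verts_def)
      ultimately have "e = (eb i, ew (f i))" using e bw i by (intro uniq) auto
      thus "e \<in> perm_matching n eb ew p" using i by (auto simp: perm_matching_def p_def)
    qed
  qed
  ultimately show ?thesis by blast
qed

lemma matching_sum_eq_perm_sum:
  fixes wt :: "'v \<times> 'v \<Rightarrow> 'r::idom"
  assumes G: "bipartite_graph G" and eb: "bij_betw eb {0..<n} (blacks G)"
    and ew: "bij_betw ew {0..<n} (whites G)"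
  shows "matching_sum G wt = (\<Sum>p\<in>edge_perms G n eb ew. \<Prod>i=0..<n. wt (eb i, ew (p i)))"
proof -
  have "bij_betw (perm_matching n eb ew) (edge_perms G n eb ew) {M. perfect_matching G M}"
    unfolding bij_betw_def
  proof
    show "inj_on (perm_matching n eb ew) (edge_perms G n eb ew)"
    proof (rule inj_onI)
      fix p q assume pq: "p \<in> edge_perms G n eb ew" "q \<in> edge_perms G n eb ew"
        "perm_matching n eb ew p = perm_matching n eb ew q"
      have pp: "p permutes {0..<n}" "q permutes {0..<n}" using pq by (auto simp: edge_perms_def)
      show "p = q"
      proof
        fix i
        show "p i = q i"
        proof (cases "i < n")
          case True
          hence "(eb i, ew (p i)) \<in> perm_matching n eb ew q"
            unfolding pq(3)[symmetric] by (auto simp: perm_matching_def)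
          then obtain j where j: "j < n" "eb i = eb j" "ew (p i) = ew (q j)"
            by (auto simp: perm_matching_def)
          have "i = j" using j True eb by (auto simp: bij_betw_def inj_on_def)
          moreover have "p i < n" "q i < n" using pp True permutes_in_image by fastforce+
          ultimately show ?thesis using j(3) ew by (auto simp: bij_betw_def inj_on_def)
        next
          case False
          thus ?thesis using pp by (simp add: permutes_not_in)
        qed
      qed
    qed
    show "perm_matching n eb ew ` edge_perms G n eb ew = {M. perfect_matching G M}"
      using perfect_perm_matching[OF G eb ew] perfect_matching_eq_perm_matching[OF G eb ew] by blast
  qed
  from sum.reindex_bij_betw[OF this, of "\<lambda>M. \<Prod>e\<in>M. wt e"]
  have "matching_sum G wt = (\<Sum>p\<in>edge_perms G n eb ew. \<Prod>e\<in>perm_matching n eb ew p. wt e)"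
    by (simp add: matching_sum_def)
  also have "\<dots> = (\<Sum>p\<in>edge_perms G n eb ew. \<Prod>i=0..<n. wt (eb i, ew (p i)))"
    unfolding perm_matching_def by (simp add: prod.reindex inj_on_perm_edge[OF eb])
  finally show ?thesis .
qed

context plane_bgraph
begin

lemma prod_cycle_edges:
  fixes \<sigma> :: "'v \<times> 'v \<Rightarrow> int"
  assumes "simple_cycle G bs ws"
  shows "(\<Prod>e\<in>cycle_edges bs ws. \<sigma> e) =
    (\<Prod>i<length bs. \<sigma> (bs ! i, ws ! i)) * (\<Prod>i<length bs. \<sigma> (bs ! (Suc i mod length bs), ws ! i))"
proof -
  let ?l = "length bs"
  define A where "A = (\<lambda>i. (bs ! i, ws ! i)) ` {..<?l}"
  define B where "B = (\<lambda>i. (bs ! (Suc i mod ?l), ws ! i)) ` {..<?l}"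
  have l: "2 \<le> ?l" and lw: "length ws = ?l" and d: "distinct bs" "distinct ws"
    using assms by (auto simp: simple_cycle_def)
  have w: "i = j" if "ws ! i = ws ! j" "i < ?l" "j < ?l" for i j
    using that d(2) lw by (simp add: nth_eq_iff_index_eq)
  have "cycle_edges bs ws = A \<union> B" by (auto simp: cycle_edges_def A_def B_def)
  moreover have "A \<inter> B = {}"
  proof (rule equals0I)
    fix e assume "e \<in> A \<inter> B"
    then obtain i j where ij: "i < ?l" "j < ?l" "(bs ! i, ws ! i) = (bs ! (Suc j mod ?l), ws ! j)"
      by (auto simp: A_def B_def)
    hence "i = j" using w by auto
    moreover have "Suc j mod ?l < ?l" using l by (intro mod_less_divisor) linarith
    ultimately have "j = Suc j mod ?l" using ij d(1) by (auto simp: nth_eq_iff_index_eq)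
    thus False using l ij(2) by (cases "Suc j = ?l") auto
  qed
  moreover have "prod \<sigma> A = (\<Prod>i<?l. \<sigma> (bs ! i, ws ! i))"
    unfolding A_def using w by (subst prod.reindex) (auto simp: inj_on_def)
  moreover have "prod \<sigma> B = (\<Prod>i<?l. \<sigma> (bs ! (Suc i mod ?l), ws ! i))"
    unfolding B_def using w by (subst prod.reindex) (auto simp: inj_on_def)
  moreover have "finite A" "finite B" by (auto simp: A_def B_def)
  ultimately show ?thesis by (simp add: prod.union_disjoint)
qed

text \<open>A perfect matching that covers the vertices of the cycle by cycle edges matches the enclosed
  vertices among themselves, as no edge crosses the cycle.\<close>

lemma alternating_cycle_encloses_even:
  assumes M: "perfect_matching G M" and cyc: "simple_cycle G bs ws"
    and alt: "\<And>i. i < length bs \<Longrightarrow> (bs ! i, ws ! i) \<in> M"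
  shows "even (card (enclosed_verts G D (cycle_edges bs ws)))"
proof (rule even_card_if_matched[of M])
  let ?C = "cycle_edges bs ws"
  have CE: "?C \<subseteq> edges G" using cyc by (simp add: simple_cycle_def)
  have ME: "M \<subseteq> edges G" and cov: "\<And>v. v \<in> verts G \<Longrightarrow> \<exists>!e. e \<in> M \<and> (v = fst e \<or> v = snd e)"
    using M by (auto simp: perfect_matching_def)
  have uniq: "e = f" if "e \<in> M" "f \<in> M" "v \<in> {fst e, snd e}" "v \<in> {fst f, snd f}" for e f v
  proof -
    have "v \<in> verts G" using that(1,3) ME edge_colours[of e] by (auto simp: verts_def)
    thus ?thesis using cov[of v] that by blast
  qed
  show "matching M" unfolding matching_def using ME uniq by blast
  show "enclosed_verts G D ?C \<subseteq> verts G" by (auto simp: enclosed_verts_def)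
  fix v assume v: "v \<in> enclosed_verts G D ?C"
  hence "v \<in> verts G" by (simp add: enclosed_verts_def)
  then obtain e where e: "e \<in> M" "v \<in> {fst e, snd e}" using cov by blast
  have "x \<in> enclosed_verts G D ?C" if x: "x \<in> {fst e, snd e}" for x
  proof (rule ccontr)
    assume "x \<notin> enclosed_verts G D ?C"
    hence "x \<in> ends ?C" using enclosed_step[OF CE _ e(2) v x] e(1) ME by blast
    then obtain i where i: "i < length bs" "x = bs ! i \<or> x = ws ! i"
    proof -
      have "Suc i mod length bs < length bs" for i
        using cyc by (intro mod_less_divisor) (auto simp: simple_cycle_def)
      thus thesis using that \<open>x \<in> ends ?C\<close> by (force simp: ends_def cycle_edges_def)
    qed
    hence "e = (bs ! i, ws ! i)" using uniq[OF e(1) alt[OF i(1)], of x] x by auto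
    hence "e \<in> ?C" using i by (auto simp: cycle_edges_def)
    hence "v \<in> ends ?C" using e(2) by (auto simp: ends_def)
    thus False using enclosed_not_end[OF CE v] by simp
  qed
  thus "\<exists>e\<in>M. v \<in> {fst e, snd e} \<and> fst e \<in> enclosed_verts G D ?C \<and> snd e \<in> enclosed_verts G D ?C"
    using e by blast
qed

text \<open>Two matchings differ by the cycles of the permutation \<open>r = p\<^sup>-\<^sup>1 \<circ> q\<close>.  Replacing \<open>q\<close> by \<open>p\<close> on one cycle of
  length \<open>l\<close> multiplies the sign of the permutation by \<open>(-1) ^ (l - 1)\<close>.  The black vertices that it permutes lie on
  an alternating cycle with \<open>2 * l\<close> edges of the graph, so the product of the edge signs changes by the
  same factor.\<close>

theorem kasteleyn_sign:
  assumes \<sigma>: "sign_function G D \<sigma>"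
    and eb: "bij_betw eb {0..<n} (blacks G)" and ew: "bij_betw ew {0..<n} (whites G)"
    and p: "p \<in> edge_perms G n eb ew" and q: "q \<in> edge_perms G n eb ew"
  shows "sign p * (\<Prod>i=0..<n. \<sigma> (eb i, ew (p i))) = sign q * (\<Prod>i=0..<n. \<sigma> (eb i, ew (q i)))"
  using q
proof (induction "card {i. p i \<noteq> q i}" arbitrary: q rule: less_induct)
  case less
  have pp: "p permutes {0..<n}" and qp: "q permutes {0..<n}"
    using p less.prems by (auto simp: edge_perms_def)
  show ?case
  proof (cases "p = q")
    case False
    then obtain x where x: "p x \<noteq> q x" by blast
    define r where "r = Hilbert_Choice.inv p \<circ> q"
    have rp: "r permutes {0..<n}" unfolding r_def by (intro permutes_compose qp permutes_inv pp)
    have pr: "p (r i) = q i" for i unfolding r_def using permutes_inverses(1)[OF pp] by simp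
    have perm: "permutation r" using rp permutation_permutes by blast
    have rx: "r x \<noteq> x" using pr[of x] x by metis
    define L where "L = support r x"
    define l where "l = least_power r x"
    have l: "2 \<le> l" unfolding l_def using least_power_gt_one[OF perm rx] by simp
    have lenL: "length L = l" by (simp add: L_def l_def)
    have L_nth: "L ! i = (r ^^ i) x" if "i < l" for i using that by (simp add: L_def l_def)
    have dL: "distinct L" unfolding L_def by (rule cycle_of_permutation[OF perm])
    have rL: "r (L ! i) = L ! (Suc i mod l)" if "i < l" for i
    proof (cases "Suc i = l")
      case True
      have "r (L ! i) = (r ^^ l) x" using L_nth[OF that] True[symmetric] by simp
      also have "\<dots> = x" unfolding l_def by (rule least_power_of_permutation[OF perm])
      finally show ?thesis using True L_nth[of 0] l by simp
    next
      case False
      hence "Suc i < l" using that by simp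
      thus ?thesis using L_nth that by simp
    qed
    have rfix: "i \<in> {0..<n}" if "r i \<noteq> i" for i using rp that by (auto simp: permutes_def)
    have Lr: "r i \<in> set L \<and> r i \<noteq> i" if iL: "i \<in> set L" for i
    proof -
      obtain j where j: "j < l" "i = L ! j" using iL lenL by (auto simp: in_set_conv_nth)
      have m: "Suc j mod l < l" using l by (intro mod_less_divisor) linarith
      have "Suc j mod l \<noteq> j" using l j by (cases "Suc j = l") auto
      hence "L ! (Suc j mod l) \<noteq> L ! j" using m j dL lenL by (simp add: nth_eq_iff_index_eq)
      thus ?thesis using rL[OF j(1)] j m lenL by simp
    qed
    have Ln: "set L \<subseteq> {0..<n}" using Lr rfix by blast
    define c where "c = cycle_of_list L"
    have cr: "c i = r i" if "i \<in> set L" for i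
      using cycle_restrict[OF perm, of i x] that by (simp add: c_def L_def)
    have cid: "c i = i" if "i \<notin> set L" for i unfolding c_def by (rule id_outside_supp[OF that])
    have cperm: "permutation c" unfolding c_def by (rule permutation_of_cycle)
    have cp: "c permutes {0..<n}"
      unfolding c_def by (rule permutes_subset[OF cycle_permutes Ln])
    \<comment> \<open>\<open>L\<close> is the cycle of \<open>r\<close> through \<open>x\<close>; on it, \<open>q'\<close> has been switched to \<open>p\<close>.\<close>
    define q' where "q' = (\<lambda>i. if i \<in> set L then p i else q i)"
    have q'c: "q = q' \<circ> c"
    proof
      fix i show "q i = (q' \<circ> c) i"
        using Lr[of i] cr[of i] cid[of i] pr[of i] by (cases "i \<in> set L") (simp_all add: q'_def)
    qed
    have "q' = q \<circ> Hilbert_Choice.inv c" unfolding q'c using permutes_inverses(1)[OF cp] by (auto simp: fun_eq_iff)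
    hence q'p: "q' permutes {0..<n}" using qp cp by (simp add: permutes_compose permutes_inv)
    have q'E: "q' \<in> edge_perms G n eb ew"
      using q'p p less.prems by (auto simp: edge_perms_def q'_def)
    have fin: "finite {i. p i \<noteq> q i}"
    proof (rule finite_subset)
      show "{i. p i \<noteq> q i} \<subseteq> {0..<n}"
      proof
        fix i assume "i \<in> {i. p i \<noteq> q i}"
        thus "i \<in> {0..<n}" 
          using permutes_not_in[OF pp, of i] permutes_not_in[OF qp, of i] by (cases "i \<in> {0..<n}") auto
      qed
    qed simp
    have "x \<in> set L" using L_nth[of 0] l lenL by (auto simp: in_set_conv_nth intro!: exI[of _ 0])
    hence "{i. p i \<noteq> q' i} \<subset> {i. p i \<noteq> q i}" using x by (auto simp: q'_def)
    hence IH: "sign p * (\<Prod>i=0..<n. \<sigma> (eb i, ew (p i))) = sign q' * (\<Prod>i=0..<n. \<sigma> (eb i, ew (q' i)))"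
      by (intro less.hyps[OF psubset_card_mono[OF fin] q'E])
    have sq: "sign q = sign q' * (-1) ^ (l - 1)"
    proof -
      have "permutation q'" using q'p permutation_permutes by blast
      thus ?thesis unfolding q'c using cperm sign_cycle_of_list[OF dL] lenL
        by (simp add: sign_compose c_def)
    qed
    let ?bs = "map eb L" and ?ws = "map (\<lambda>i. ew (q i)) L"
    have qb: "bij_betw (\<lambda>i. ew (q i)) {0..<n} (whites G)"
      using bij_betw_trans[OF permutes_imp_bij[OF qp] ew] by (simp add: comp_def)
    have m: "Suc i mod l < l" for i using l by (intro mod_less_divisor) linarith
    have Lnth: "L ! i < n" if "i < l" for i using subsetD[OF Ln nth_mem[of i L]] that lenL by simp
    have second: "(?bs ! (Suc i mod l), ?ws ! i) = (eb (L ! (Suc i mod l)), ew (p (L ! (Suc i mod l))))"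
      if "i < l" for i
      using that m[of i] lenL pr[of "L ! i"] rL[OF that] by simp
    have cyc: "simple_cycle G ?bs ?ws"
      unfolding simple_cycle_def
    proof (intro conjI)
      show "distinct ?bs"
        using dL eb Ln by (auto simp: distinct_map bij_betw_def intro: inj_on_subset)
      show "distinct ?ws"
        using dL qb Ln by (auto simp: distinct_map bij_betw_def intro: inj_on_subset)
      show "cycle_edges ?bs ?ws \<subseteq> edges G"
      proof
        fix e assume "e \<in> cycle_edges ?bs ?ws"
        then obtain i where i: "i < l" "e = (?bs ! i, ?ws ! i) \<or> e = (?bs ! (Suc i mod l), ?ws ! i)"
          using lenL by (auto simp: cycle_edges_def)
        show "e \<in> edges G"
          using i second[OF i(1)] p less.prems Lnth[OF i(1)] Lnth[OF m[of i]] lenL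
          by (auto simp: edge_perms_def)
      qed
    qed (use l lenL in auto)
    have "even (card (enclosed_verts G D (cycle_edges ?bs ?ws)))"
      using Lnth lenL
      by (intro alternating_cycle_encloses_even[OF perfect_perm_matching[OF bipartite eb ew less.prems] cyc])
        (auto simp: perm_matching_def)
    hence "(\<Prod>e\<in>cycle_edges ?bs ?ws. \<sigma> e) = (-1) ^ (length ?bs - 1)"
      using \<sigma> cyc unfolding sign_function_def by blast
    moreover have "(\<Prod>e\<in>cycle_edges ?bs ?ws. \<sigma> e) =
        (\<Prod>i<l. \<sigma> (?bs ! i, ?ws ! i)) * (\<Prod>i<l. \<sigma> (?bs ! (Suc i mod l), ?ws ! i))"
      using prod_cycle_edges[OF cyc, of \<sigma>] lenL by simp
    moreover have "(\<Prod>i<l. \<sigma> (?bs ! i, ?ws ! i)) = (\<Prod>i\<in>set L. \<sigma> (eb i, ew (q i)))"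
    proof -
      have "bij_betw (\<lambda>i. L ! i) {..<l} (set L)"
        using dL lenL by (intro bij_betw_nth) auto
      from prod.reindex_bij_betw[OF this, of "\<lambda>i. \<sigma> (eb i, ew (q i))"]
      show ?thesis using lenL by simp
    qed
    moreover have "(\<Prod>i<l. \<sigma> (?bs ! (Suc i mod l), ?ws ! i)) = (\<Prod>i\<in>set L. \<sigma> (eb i, ew (p i)))"
    proof -
      have b: "bij_betw r (set L) (set L)"
        using permutes_imp_bij[OF cycle_permutes[of L]] cr unfolding c_def[symmetric]
        by (simp cong: bij_betw_cong)
      have "bij_betw (\<lambda>i. L ! i) {..<l} (set L)"
        using dL lenL by (intro bij_betw_nth) auto
      hence b: "bij_betw (\<lambda>i. r (L ! i)) {..<l} (set L)"
        using bij_betw_trans[OF _ b] by (simp add: comp_def)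
      have "(\<Prod>i<l. \<sigma> (?bs ! (Suc i mod l), ?ws ! i)) =
          (\<Prod>i<l. \<sigma> (eb (r (L ! i)), ew (p (r (L ! i)))))"
        using second rL by (intro prod.cong) auto
      also have "\<dots> = (\<Prod>i\<in>set L. \<sigma> (eb i, ew (p i)))"
        using prod.reindex_bij_betw[OF b, of "\<lambda>i. \<sigma> (eb i, ew (p i))"] by simp
      finally show ?thesis .
    qed
    ultimately have cycle_prod:
      "(\<Prod>i\<in>set L. \<sigma> (eb i, ew (q i))) * (\<Prod>i\<in>set L. \<sigma> (eb i, ew (p i))) = (-1) ^ (l - 1)"
      using lenL by simp
    have split: "(\<Prod>i=0..<n. f i) = (\<Prod>i\<in>set L. f i) * (\<Prod>i\<in>{0..<n} - set L. f i)" for f :: "nat \<Rightarrow> int"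
      using Ln by (metis finite_atLeastLessThan mult.commute prod.subset_diff)
    have "(\<Prod>i\<in>set L. \<sigma> (eb i, ew (q i))) * (\<Prod>i\<in>set L. \<sigma> (eb i, ew (q i))) = 1"
      unfolding prod.distrib[symmetric]
    proof (rule prod.neutral, rule ballI)
      fix i assume "i \<in> set L"
      hence "(eb i, ew (q i)) \<in> edges G" using Ln less.prems by (auto simp: edge_perms_def)
      hence "\<sigma> (eb i, ew (q i)) \<in> {1, -1}" using \<sigma> unfolding sign_function_def by blast
      thus "\<sigma> (eb i, ew (q i)) * \<sigma> (eb i, ew (q i)) = 1" by auto
    qed
    moreover have "(\<Prod>i=0..<n. \<sigma> (eb i, ew (q' i))) =
        (\<Prod>i\<in>set L. \<sigma> (eb i, ew (p i))) * (\<Prod>i\<in>{0..<n} - set L. \<sigma> (eb i, ew (q i)))"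
      unfolding split by (auto simp: q'_def intro!: prod.cong arg_cong2[of _ _ _ _ "(*)"])
    ultimately have "sign q * (\<Prod>i=0..<n. \<sigma> (eb i, ew (q i))) = sign q' * (\<Prod>i=0..<n. \<sigma> (eb i, ew (q' i)))"
      unfolding sq split[of "\<lambda>i. \<sigma> (eb i, ew (q i))"] cycle_prod[symmetric]
      by (simp add: algebra_simps)
    thus ?thesis using IH by simp
  qed simp
qed

end

section \<open>Copies of the base graph inside a compound graph\<close>

lemma connected_component_homeomorphism:
  assumes f: "homeomorphism UNIV UNIV f g" and c: "connected_component (- S) x y"
  shows "connected_component (- (f ` S)) (f x) (f y)"
proof -
  obtain T where T: "connected T" "T \<subseteq> - S" "x \<in> T" "y \<in> T"
    using c by (auto simp: connected_component_def)
  have "continuous_on T f" using f by (auto simp: homeomorphism_def intro: continuous_on_subset)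
  hence "connected (f ` T)" using T(1) by (rule connected_continuous_image)
  moreover have "f ` T \<subseteq> - (f ` S)"
  proof -
    have "g (f z) = z" for z using f by (simp add: homeomorphism_def)
    hence "inj f" by (metis injI)
    thus ?thesis using T(2) by (auto simp: inj_def)
  qed
  ultimately show ?thesis using T(3,4) by (auto simp: connected_component_def)
qed

text \<open>A homeomorphism of the plane maps components of the complement of \<open>S\<close> to components of the
  complement of the image, and preserves boundedness in both directions.\<close>

lemma inside_homeomorphism_image:
  fixes f :: "complex \<Rightarrow> complex"
  assumes f: "homeomorphism UNIV UNIV f g"
  shows "inside (f ` S) = f ` inside S"
proof -
  have *: "f x \<in> inside (f ` S)" if f: "homeomorphism UNIV UNIV f g" and x: "x \<in> inside S"
    for f g :: "complex \<Rightarrow> complex" and S x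
  proof -
    have gf: "g (f z) = z" and fg: "f (g z) = z" for z using f by (simp_all add: homeomorphism_def)
    have "f x \<notin> f ` S" using x gf by (auto simp: inside_def) (metis gf)
    moreover have "bounded (connected_component_set (- (f ` S)) (f x))"
    proof (rule bounded_subset)
      have "bounded (connected_component_set (- S) x)" using x by (simp add: inside_def)
      hence "compact (f ` closure (connected_component_set (- S) x))"
        using f by (intro compact_continuous_image)
          (auto simp: compact_closure homeomorphism_def intro: continuous_on_subset)
      thus "bounded (f ` closure (connected_component_set (- S) x))" by (rule compact_imp_bounded)
      show "connected_component_set (- (f ` S)) (f x) \<subseteq> f ` closure (connected_component_set (- S) x)"
      proof
        fix y assume "y \<in> connected_component_set (- (f ` S)) (f x)"
        hence "connected_component (- (g ` f ` S)) (g (f x)) (g y)"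
          using connected_component_homeomorphism[OF homeomorphism_symD[OF f]] by blast
        moreover have "g ` f ` S = S" by (simp add: image_image gf)
        ultimately have "g y \<in> closure (connected_component_set (- S) x)"
          using gf closure_subset by fastforce
        thus "y \<in> f ` closure (connected_component_set (- S) x)" using fg by (metis image_eqI)
      qed
    qed
    ultimately show ?thesis by (simp add: inside_def)
  qed
  have gf: "g (f z) = z" and fg: "f (g z) = z" for z using f by (simp_all add: homeomorphism_def)
  have "z \<in> f ` inside S" if "z \<in> inside (f ` S)" for z
  proof -
    have "g z \<in> inside (g ` f ` S)" by (rule *[OF homeomorphism_symD[OF f] that])
    moreover have "g ` f ` S = S" by (simp add: image_image gf)
    ultimately show ?thesis using fg by (metis image_eqI)
  qed
  thus ?thesis using *[OF f] by blast
qed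

lemma isotopic_to_id_homeomorphism:
  assumes "isotopic_to_id \<phi>" shows "\<exists>g. homeomorphism UNIV UNIV \<phi> g"
proof -
  obtain h :: "real \<times> complex \<Rightarrow> complex"
    where h: "\<forall>t\<in>{0..1}. \<exists>g. homeomorphism UNIV UNIV (\<lambda>z. h (t, z)) g" "\<forall>z. h (1, z) = \<phi> z"
    using assms unfolding isotopic_to_id_def by blast
  have "(\<lambda>z. h (1, z)) = \<phi>" using h(2) by auto
  thus ?thesis using bspec[OF h(1), of 1] by simp
qed

lemma places_copy_homeomorphism:
  assumes "places_copy H s \<phi>" "s \<in> verts (super H)"
  shows "\<exists>g. homeomorphism UNIV UNIV \<phi> g"
proof (cases "s \<in> blacks (super H)")
  case True
  thus ?thesis using assms isotopic_to_id_homeomorphism by (simp add: places_copy_def)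
next
  case False
  hence "isotopic_to_id (\<phi> \<circ> cnj)" using assms by (auto simp: places_copy_def verts_def)
  then obtain g where g: "homeomorphism UNIV UNIV (\<phi> \<circ> cnj) g"
    using isotopic_to_id_homeomorphism by blast
  have "homeomorphism UNIV UNIV cnj cnj"
    by (auto simp: homeomorphism_def intro!: continuous_intros) (metis UNIV_I complex_cnj_cnj image_eqI)+
  hence "homeomorphism UNIV UNIV ((\<phi> \<circ> cnj) \<circ> cnj) (cnj \<circ> g)"
    using g by (rule homeomorphism_compose)
  moreover have "(\<phi> \<circ> cnj) \<circ> cnj = \<phi>" by auto
  ultimately show ?thesis by auto
qed

fun copy_edge :: "'s \<Rightarrow> 'v \<times> 'v \<Rightarrow> ('v, 's, 't, 'l) cvertex \<times> ('v, 's, 't, 'l) cvertex" where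
  "copy_edge s (b, w) = (Base s b, Base s w)"

lemma inj_copy_edge: "inj_on (copy_edge s) F"
  by (rule inj_onI) (auto elim!: copy_edge.elims)

lemma bipartite_total_graph:
  assumes "compound_graph H" shows "bipartite_graph (total_graph H)"
proof -
  have fin: "finite (verts (super H))" "finite (blacks (base H))" "finite (whites (base H))"
    and disj: "blacks (base H) \<inter> whites (base H) = {}"
    and E: "edges (base H) \<subseteq> blacks (base H) \<times> whites (base H)"
    and st: "\<And>t. t \<in> stems H \<Longrightarrow> stem_edge H t \<in> edges (super H) \<and> stem_at H t \<in> whites (base H)"
    and lf: "\<And>l. l \<in> leaves H \<Longrightarrow> leaf_copy H l \<in> verts (super H) \<and> leaf_at H l \<in> blacks (base H)"
    and fsl: "finite (stems H)" "finite (leaves H)"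
    and sE: "edges (super H) \<subseteq> blacks (super H) \<times> whites (super H)"
    using assms by (auto simp: compound_graph_def bipartite_graph_def verts_def)
  have sv: "fst (stem_edge H t) \<in> verts (super H)" "snd (stem_edge H t) \<in> verts (super H)"
    if "t \<in> stems H" for t
    using st[OF that] sE by (auto simp: verts_def)
  have f: "finite {Base s v | s v. s \<in> verts (super H) \<and> v \<in> V}" if "finite V" for V
    using finite_image_set2[of "\<lambda>s. s \<in> verts (super H)" "\<lambda>v. v \<in> V" Base] fin(1) that by simp
  show ?thesis
    unfolding bipartite_graph_def
  proof (intro conjI)
    show "edges (total_graph H) \<subseteq> blacks (total_graph H) \<times> whites (total_graph H)"
      using E st lf sv by (auto simp: total_graph_def)
  qed (use fin fsl f disj in \<open>auto simp: total_graph_def\<close>)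
qed

lemma compound_plane_bgraph:
  assumes "compound_graph H"
  shows "plane_bgraph (total_graph H) (total_drawing H)" "plane_bgraph (base H) (base_drawing H)"
  using assms bipartite_total_graph by (auto simp: compound_graph_def plane_bgraph_def)

lemma base_in_total:
  assumes "s \<in> verts (super H)"
  shows "v \<in> verts (base H) \<Longrightarrow> Base s v \<in> verts (total_graph H)"
    "e \<in> edges (base H) \<Longrightarrow> copy_edge s e \<in> edges (total_graph H)"
proof -
  show "v \<in> verts (base H) \<Longrightarrow> Base s v \<in> verts (total_graph H)"
    using assms by (auto simp: total_graph_def verts_def)
  show "e \<in> edges (base H) \<Longrightarrow> copy_edge s e \<in> edges (total_graph H)"
    using assms by (cases e) (auto simp: total_graph_def)
qed

text \<open>Apart from the vertices of the copy itself, everything is drawn in the outer face of the copy, so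
  edges of the copy enclose the same vertices as in the base graph.\<close>

lemma enclosed_copy:
  assumes H: "compound_graph H" and s: "s \<in> verts (super H)" and F: "F \<subseteq> edges (base H)"
  shows "enclosed_verts (total_graph H) (total_drawing H) (copy_edge s ` F) =
    Base s ` enclosed_verts (base H) (base_drawing H) F"
proof -
  interpret T: plane_bgraph "total_graph H" "total_drawing H" by (rule compound_plane_bgraph[OF H])
  interpret B: plane_bgraph "base H" "base_drawing H" by (rule compound_plane_bgraph[OF H])
  let ?dr = "drawn_set (base H) (base_drawing H)"
  obtain \<phi> where \<phi>: "places_copy H s \<phi>"
    and rest: "drawn_set (total_graph H) (total_drawing H) - \<phi> ` ?dr \<subseteq> outside (\<phi> ` ?dr)"
    using H s unfolding compound_graph_def by blast
  obtain g where g: "homeomorphism UNIV UNIV \<phi> g" using places_copy_homeomorphism[OF \<phi> s] by blast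
  have inj: "\<phi> x = \<phi> y \<longleftrightarrow> x = y" for x y using g unfolding homeomorphism_def by (metis UNIV_I)
  have pt: "point (total_drawing H) (Base s v) = \<phi> (point (base_drawing H) v)"
    if "v \<in> verts (base H)" for v using \<phi> that by (simp add: places_copy_def)
  have cv: "path_image (curve (total_drawing H) (copy_edge s e)) = \<phi> ` path_image (curve (base_drawing H) e)"
    if "e \<in> edges (base H)" for e using \<phi> that by (cases e) (auto simp: places_copy_def)
  have im: "T.img (copy_edge s ` F) = \<phi> ` B.img F"
  proof -
    have "T.img (copy_edge s ` F) = (\<Union>e\<in>F. path_image (curve (total_drawing H) (copy_edge s e)))"
      by (simp add: T.img_def)
    also have "\<dots> = (\<Union>e\<in>F. \<phi> ` path_image (curve (base_drawing H) e))"
      using cv F by (intro SUP_cong) auto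
    finally show ?thesis by (simp add: B.img_def image_UN)
  qed
  have sub: "B.img F \<subseteq> ?dr" using F by (auto simp: B.img_def drawn_set_def)
  have ins: "inside (\<phi> ` B.img F) = \<phi> ` inside (B.img F)"
    by (rule inside_homeomorphism_image[OF g])
  show ?thesis
  proof
    show "Base s ` enclosed_verts (base H) (base_drawing H) F \<subseteq>
        enclosed_verts (total_graph H) (total_drawing H) (copy_edge s ` F)"
      using base_in_total(1)[OF s] pt by (auto simp: T.enclosed_verts_img B.enclosed_verts_img im ins)
    show "enclosed_verts (total_graph H) (total_drawing H) (copy_edge s ` F) \<subseteq>
        Base s ` enclosed_verts (base H) (base_drawing H) F"
    proof
      fix u assume u: "u \<in> enclosed_verts (total_graph H) (total_drawing H) (copy_edge s ` F)"
      hence uV: "u \<in> verts (total_graph H)"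
        and up: "point (total_drawing H) u \<in> \<phi> ` inside (B.img F)"
        by (auto simp: T.enclosed_verts_img im ins)
      have "point (total_drawing H) u \<in> drawn_set (total_graph H) (total_drawing H)"
        using uV by (auto simp: drawn_set_def)
      moreover have "point (total_drawing H) u \<notin> outside (\<phi> ` ?dr)"
      proof
        assume "point (total_drawing H) u \<in> outside (\<phi> ` ?dr)"
        hence "point (total_drawing H) u \<in> outside (\<phi> ` B.img F)"
          using outside_mono[OF image_mono[OF sub]] by blast
        thus False using up inside_Int_outside[of "\<phi> ` B.img F"] unfolding ins by blast
      qed
      ultimately have "point (total_drawing H) u \<in> \<phi> ` ?dr" using rest by blast
      hence "\<exists>v\<in>verts (base H). u = Base s v"
        unfolding drawn_set_def image_Un
      proof
        assume "point (total_drawing H) u \<in> \<phi> ` point (base_drawing H) ` verts (base H)"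
        then obtain v where v: "v \<in> verts (base H)"
            "point (total_drawing H) u = point (total_drawing H) (Base s v)"
          using pt by auto
        thus ?thesis using T.point_eq_iff[OF uV base_in_total(1)[OF s v(1)]] by auto
      next
        assume "point (total_drawing H) u \<in>
          \<phi> ` (\<Union>e\<in>edges (base H). path_image (curve (base_drawing H) e))"
        then obtain e where e: "e \<in> edges (base H)"
            "point (total_drawing H) u \<in> path_image (curve (total_drawing H) (copy_edge s e))"
          using cv by auto
        have "u = fst (copy_edge s e) \<or> u = snd (copy_edge s e)"
          by (rule T.point_on_curve[OF base_in_total(2)[OF s e(1)] uV e(2)])
        thus ?thesis using e(1) B.edge_colours[OF e(1)] by (cases e) (auto simp: verts_def)
      qed
      then obtain v where v: "v \<in> verts (base H)" "u = Base s v" by blast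
      hence "point (base_drawing H) v \<in> inside (B.img F)" using up pt inj by auto
      thus "u \<in> Base s ` enclosed_verts (base H) (base_drawing H) F"
        using v by (auto simp: B.enclosed_verts_img)
    qed
  qed
qed

lemma sign_function_copy:
  assumes H: "compound_graph H" and s: "s \<in> verts (super H)"
    and \<sigma>: "sign_function (total_graph H) (total_drawing H) \<sigma>"
  shows "sign_function (base H) (base_drawing H) (\<lambda>e. \<sigma> (copy_edge s e))"
  unfolding sign_function_def
proof (intro conjI allI ballI impI)
  fix e assume "e \<in> edges (base H)"
  thus "\<sigma> (copy_edge s e) \<in> {1, -1}"
    using \<sigma> base_in_total(2)[OF s] unfolding sign_function_def by blast
next
  fix bs ws
  assume cyc: "simple_cycle (base H) bs ws"
    and ev: "even (card (enclosed_verts (base H) (base_drawing H) (cycle_edges bs ws)))"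
  let ?bs = "map (Base s) bs" and ?ws = "map (Base s) ws"
  have l: "length ws = length bs" "2 \<le> length bs" using cyc by (auto simp: simple_cycle_def)
  have m: "Suc i mod length bs < length bs" for i using l by (intro mod_less_divisor) linarith
  have ce: "cycle_edges ?bs ?ws = copy_edge s ` cycle_edges bs ws"
    using m l by (simp add: cycle_edges_def image_UN)
  have CE: "cycle_edges bs ws \<subseteq> edges (base H)" using cyc by (simp add: simple_cycle_def)
  have "simple_cycle (total_graph H) ?bs ?ws"
    using cyc base_in_total(2)[OF s] CE unfolding simple_cycle_def ce
    by (auto simp: distinct_map inj_on_def)
  moreover have "even (card (enclosed_verts (total_graph H) (total_drawing H) (cycle_edges ?bs ?ws)))"
    unfolding ce enclosed_copy[OF H s CE] using ev by (simp add: card_image inj_on_def)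
  ultimately have "(\<Prod>e\<in>cycle_edges ?bs ?ws. \<sigma> e) = (-1) ^ (length bs - 1)"
    using \<sigma> unfolding sign_function_def by (metis length_map)
  thus "(\<Prod>e\<in>cycle_edges bs ws. \<sigma> (copy_edge s e)) = (-1) ^ (length bs - 1)"
    unfolding ce by (simp add: prod.reindex inj_copy_edge)
qed

text \<open>Base vertices off the outer face have no neighbours among stems and leaves.\<close>

lemma near_matching_of_copy:
  fixes H :: "('v, 's, 't, 'l) compound"
  assumes H: "compound_graph H" and s: "s \<in> verts (super H)"
    and M: "perfect_matching (total_graph H) M"
  shows "plane_bgraph.near_matching (base H) {v. on_outer_face (base H) (base_drawing H) v}
           {e. copy_edge s e \<in> M}"
proof -
  interpret T: plane_bgraph "total_graph H" "total_drawing H" by (rule compound_plane_bgraph[OF H])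
  interpret B: plane_bgraph "base H" "base_drawing H" by (rule compound_plane_bgraph[OF H])
  have ME: "M \<subseteq> edges (total_graph H)"
    and cov: "\<And>v. v \<in> verts (total_graph H) \<Longrightarrow> \<exists>!e. e \<in> M \<and> (v = fst e \<or> v = snd e)"
    using M by (auto simp: perfect_matching_def)
  have uniq: "e = f" if "e \<in> M" "f \<in> M" "v \<in> verts (total_graph H)"
      "v \<in> {fst e, snd e}" "v \<in> {fst f, snd f}" for e f v
    using cov[OF that(3)] that(1,2,4,5) by blast
  let ?N = "{e. copy_edge s e \<in> M}"
  have NE: "?N \<subseteq> edges (base H)"
    using ME by (auto simp: total_graph_def)
  have "B.matching ?N"
    unfolding B.matching_def
  proof (intro conjI ballI impI)
    fix e f assume ef: "e \<in> ?N" "f \<in> ?N" "{fst e, snd e} \<inter> {fst f, snd f} \<noteq> {}"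
    then obtain v where v: "v \<in> {fst e, snd e}" "v \<in> {fst f, snd f}" by blast
    have "v \<in> verts (base H)" using v(1) ef(1) NE B.edge_colours[of e] by (auto simp: verts_def)
    hence "Base s v \<in> verts (total_graph H)" by (rule base_in_total(1)[OF s])
    hence "copy_edge s e = (copy_edge s f :: ('v, 's, 't, 'l) cvertex \<times> ('v, 's, 't, 'l) cvertex)"
    proof (rule uniq[rotated 2])
      show "Base s v \<in> {fst (copy_edge s e), snd (copy_edge s e)}" using v(1) by (cases e) auto
      show "Base s v \<in> {fst (copy_edge s f), snd (copy_edge s f)}" using v(2) by (cases f) auto
    qed (use ef(1,2) in simp_all)
    thus "e = f" by (rule inj_onD[OF inj_copy_edge[of s UNIV]]) simp_all
  qed (rule NE)
  moreover have "\<exists>e\<in>?N. v \<in> {fst e, snd e}"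
    if v: "v \<in> verts (base H)" "\<not> on_outer_face (base H) (base_drawing H) v" for v
  proof -
    obtain e where e: "e \<in> M" "Base s v = fst e \<or> Base s v = snd e"
      using cov[OF base_in_total(1)[OF s v(1)]] by blast
    have not_at: "v \<noteq> stem_at H t" if "t \<in> stems H" for t
      using H that v(2) unfolding compound_graph_def by blast
    have not_at': "v \<noteq> leaf_at H l" if "l \<in> leaves H" for l
      using H that v(2) unfolding compound_graph_def by blast
    have "e \<in> edges (total_graph H)" using e(1) ME by blast
    hence "\<exists>s' b w. e = (Base s' b, Base s' w)"
      using e(2) not_at not_at' by (auto simp: total_graph_def)
    then obtain s' b w where bw: "e = (Base s' b, Base s' w)" by blast
    hence "s' = s" "v \<in> {b, w}" using e(2) by auto
    thus ?thesis using e(1) bw by (intro bexI[of _ "(b, w)"]) auto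
  qed
  ultimately show ?thesis unfolding B.near_matching_def by blast
qed

section \<open>Sign-weighted matching sums as determinants\<close>

text \<open>The matrix whose determinant is expanded; the first index is the black vertex.  The weight function will be
  \<open>wt\<close> multiplied by one sign function of the base graph that is common to all
  members of the family.\<close>

definition entry ::
    "('v, 's, 't, 'l) compound \<Rightarrow> ('v \<times> 'v \<Rightarrow> 'r::idom) \<Rightarrow>
     ('v, 's, 't, 'l) cvertex \<Rightarrow> ('v, 's, 't, 'l) cvertex \<Rightarrow> 'r" where
  "entry H wt x y = (if (x, y) \<in> edges (total_graph H) then compound_weight wt (x, y) else 0)"

text \<open>The extension of a gauge from the base graph to a compound graph.  A stem or leaf copies the value of the base
  vertex to which it is joined, so the two ends of its edges contribute \<open>\<alpha> v * \<alpha> v = 1\<close>.\<close>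

fun spread :: "('v, 's, 't, 'l) compound \<Rightarrow> ('v \<Rightarrow> int) \<Rightarrow> ('v, 's, 't, 'l) cvertex \<Rightarrow> int" where
  "spread H \<alpha> (Base s v) = \<alpha> v"
| "spread H \<alpha> (Stem t) = \<alpha> (stem_at H t)"
| "spread H \<alpha> (Leaf l) = \<alpha> (leaf_at H l)"

text \<open>Edge by edge, the two products differ by \<open>\<sigma> e\<close> and the gauge values of the two endpoints.  The gauge
  contributes the product over all vertices, whatever the matching, and the product of the \<open>\<sigma> e\<close> is
  controlled by \<open>kasteleyn_sign\<close>.\<close>

lemma kasteleyn_entries:
  fixes wt :: "'v \<times> 'v \<Rightarrow> 'r::idom"
  assumes H: "compound_graph H" and s0: "s0 \<in> verts (super H)" and \<sigma>: "\<sigma> \<in> sign_functions H"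
    and \<rho>: "sign_function (base H) (base_drawing H) \<rho>"
    and eb: "bij_betw eb {0..<n} (blacks (total_graph H))"
    and ew: "bij_betw ew {0..<n} (whites (total_graph H))"
  shows "\<exists>\<kappa>\<in>{1, -1 :: int}. \<forall>p\<in>edge_perms (total_graph H) n eb ew.
    of_int (sign p) * (\<Prod>i=0..<n. compound_weight (\<lambda>e. of_int (\<rho> e) * wt e) (eb i, ew (p i))) =
    of_int \<kappa> * (\<Prod>i=0..<n. sign_weight wt \<sigma> (eb i, ew (p i)))"
proof -
  interpret T: plane_bgraph "total_graph H" "total_drawing H" by (rule compound_plane_bgraph[OF H])
  interpret B: plane_bgraph "base H" "base_drawing H" by (rule compound_plane_bgraph[OF H])
  let ?a = "compound_weight (\<lambda>e. of_int (\<rho> e) * wt e)"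
  let ?O = "{v. on_outer_face (base H) (base_drawing H) v}"
  have \<sigma>T: "sign_function (total_graph H) (total_drawing H) \<sigma>"
    and \<sigma>eq: "\<And>s b w. s \<in> verts (super H) \<Longrightarrow> (b, w) \<in> edges (base H) \<Longrightarrow>
        \<sigma> (Base s b, Base s w) = \<sigma> (Base s0 b, Base s0 w)"
    using \<sigma> s0 unfolding sign_functions_def by blast+
  have val: "\<sigma> e \<in> {1, -1}" if "e \<in> edges (total_graph H)" for e
    using \<sigma>T that unfolding sign_function_def by blast
  obtain \<alpha> where \<alpha>: "\<And>v. \<alpha> v \<in> {1, -1 :: int}"
    "\<And>b w. (b, w) \<in> B.allowed ?O \<Longrightarrow> \<sigma> (copy_edge s0 (b, w)) * \<rho> (b, w) = \<alpha> b * \<alpha> w"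
    using B.sign_functions_differ_by_gauge[OF sign_function_copy[OF H s0 \<sigma>T] \<rho>] by metis
  define A where "A = spread H \<alpha>"
  have A: "A v \<in> {1, -1}" for v using \<alpha>(1) by (cases v) (auto simp: A_def)
  have sq: "\<alpha> v * \<alpha> v = 1" for v using \<alpha>(1)[of v] by auto
  have entry: "?a e = of_int (\<sigma> e * (A (fst e) * A (snd e))) * sign_weight wt \<sigma> e"
    if M: "perfect_matching (total_graph H) M" and e: "e \<in> M" for M e
  proof -
    have eE: "e \<in> edges (total_graph H)" using M e by (auto simp: perfect_matching_def)
    have \<sigma>sq: "\<sigma> e * \<sigma> e = 1" using val[OF eE] by auto
    have \<sigma>sq': "of_int (\<sigma> e) * of_int (\<sigma> e) = (1 :: 'r)"
      using \<sigma>sq by (metis of_int_1 of_int_mult)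
    consider (base) s b w where "e = (Base s b, Base s w)" "s \<in> verts (super H)" "(b, w) \<in> edges (base H)"
      | (stem) t s where "e = (Stem t, Base s (stem_at H t))"
      | (leaf) l s where "e = (Base s (leaf_at H l), Leaf l)"
      using eE by (auto simp: total_graph_def)
    thus ?thesis
    proof cases
      case base
      have "B.near_matching ?O {e. copy_edge s e \<in> M}" by (rule near_matching_of_copy[OF H base(2) M])
      hence "(b, w) \<in> B.allowed ?O" using e base(1) B.near_matching_subset by fastforce
      hence "\<sigma> e * \<rho> (b, w) = \<alpha> b * \<alpha> w" using \<alpha>(2) \<sigma>eq[OF base(2,3)] base(1) by simp
      hence "\<rho> (b, w) = \<sigma> e * (\<alpha> b * \<alpha> w)" using \<sigma>sq
        by (metis mult.assoc mult_1)
      thus ?thesis using base(1) by (simp add: A_def sign_weight_def)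
    next
      case stem
      thus ?thesis using \<sigma>sq' sq by (simp add: A_def sign_weight_def)
    next
      case leaf
      thus ?thesis using \<sigma>sq' sq by (simp add: A_def sign_weight_def)
    qed
  qed
  define K where "K = (\<Prod>i=0..<n. A (eb i)) * (\<Prod>i=0..<n. A (ew i))"
  have pm: "(\<Prod>i\<in>I. f i) \<in> {1, -1 :: int}" if "\<And>i. i \<in> I \<Longrightarrow> f i \<in> {1, -1 :: int}" for f and I :: "nat set"
  proof -
    have "\<bar>\<Prod>i\<in>I. f i\<bar> = (\<Prod>i\<in>I. \<bar>f i\<bar>)" by (rule abs_prod)
    also have "\<dots> = 1" by (intro prod.neutral ballI) (use that in force)
    finally show ?thesis by auto
  qed
  have by_sign: "of_int (sign p) * (\<Prod>i=0..<n. ?a (eb i, ew (p i))) =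
      of_int (sign p * (\<Prod>i=0..<n. \<sigma> (eb i, ew (p i))) * K) * (\<Prod>i=0..<n. sign_weight wt \<sigma> (eb i, ew (p i)))"
    if p: "p \<in> edge_perms (total_graph H) n eb ew" for p
  proof -
    have pp: "p permutes {0..<n}" using p by (simp add: edge_perms_def)
    have "(\<Prod>i=0..<n. ?a (eb i, ew (p i))) = (\<Prod>i=0..<n. 
        of_int (\<sigma> (eb i, ew (p i)) * (A (eb i) * A (ew (p i)))) * sign_weight wt \<sigma> (eb i, ew (p i)))"
      using entry[OF perfect_perm_matching[OF T.bipartite eb ew p]]
      by (intro prod.cong) (auto simp: perm_matching_def)
    also have "\<dots> = of_int ((\<Prod>i=0..<n. \<sigma> (eb i, ew (p i))) *
          ((\<Prod>i=0..<n. A (eb i)) * (\<Prod>i=0..<n. A (ew (p i))))) *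
        (\<Prod>i=0..<n. sign_weight wt \<sigma> (eb i, ew (p i)))"
      by (simp add: prod.distrib)
    also have "(\<Prod>i=0..<n. A (ew (p i))) = (\<Prod>i=0..<n. A (ew i))"
      using prod.permute[OF pp, of "\<lambda>i. A (ew i)"] by (simp add: comp_def)
    finally show ?thesis by (simp add: K_def mult.assoc)
  qed
  show ?thesis
  proof (cases "edge_perms (total_graph H) n eb ew = {}")
    case True thus ?thesis by auto
  next
    case False
    then obtain q where q: "q \<in> edge_perms (total_graph H) n eb ew" by blast
    define \<kappa> where "\<kappa> = sign q * (\<Prod>i=0..<n. \<sigma> (eb i, ew (q i))) * K"
    have "(\<Prod>i=0..<n. \<sigma> (eb i, ew (q i))) \<in> {1, -1}"
      using q val by (intro pm) (auto simp: edge_perms_def)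
    moreover have "(\<Prod>i=0..<n. A (eb i)) \<in> {1, -1}" "(\<Prod>i=0..<n. A (ew i)) \<in> {1, -1}"
      by (rule pm, rule A)+
    moreover have "sign q \<in> {1, -1}" by (simp add: sign_def)
    ultimately have "\<kappa> \<in> {1, -1}" by (auto simp: \<kappa>_def K_def)
    moreover have "sign p * (\<Prod>i=0..<n. \<sigma> (eb i, ew (p i))) * K = \<kappa>"
      if "p \<in> edge_perms (total_graph H) n eb ew" for p
      unfolding \<kappa>_def using T.kasteleyn_sign[OF \<sigma>T eb ew that q] by simp
    ultimately show ?thesis using by_sign by (intro bexI[of _ \<kappa>]) auto
  qed
qed

lemma det_eq_sign_weighted_sum:
  fixes wt :: "'v \<times> 'v \<Rightarrow> 'r::idom"
  assumes H: "compound_graph H" and s0: "s0 \<in> verts (super H)" and \<sigma>: "\<sigma> \<in> sign_functions H"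
    and \<rho>: "sign_function (base H) (base_drawing H) \<rho>"
    and eb: "bij_betw eb {0..<n::nat} (blacks (total_graph H))"
    and ew: "bij_betw ew {0..<n} (whites (total_graph H))"
  shows "\<exists>\<kappa>\<in>{1, -1 :: int}.
    (\<Sum>p | p permutes {0..<n}. of_int (sign p) *
       (\<Prod>i=0..<n. entry H (\<lambda>e. of_int (\<rho> e) * wt e) (eb i) (ew (p i)))) =
    of_int \<kappa> * sign_weighted_sum H wt \<sigma>"
proof -
  let ?T = "total_graph H" and ?wt = "\<lambda>e. of_int (\<rho> e) * wt e"
  obtain \<kappa> where \<kappa>: "\<kappa> \<in> {1, -1 :: int}" and eq: "\<And>p. p \<in> edge_perms ?T n eb ew \<Longrightarrow>
    of_int (sign p) * (\<Prod>i=0..<n. compound_weight ?wt (eb i, ew (p i))) =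
    of_int \<kappa> * (\<Prod>i=0..<n. sign_weight wt \<sigma> (eb i, ew (p i)))"
    using kasteleyn_entries[OF H s0 \<sigma> \<rho> eb ew, of wt] by blast
  have "(\<Sum>p | p permutes {0..<n}. of_int (sign p) * (\<Prod>i=0..<n. entry H ?wt (eb i) (ew (p i)))) =
      (\<Sum>p\<in>edge_perms ?T n eb ew. of_int (sign p) * (\<Prod>i=0..<n. entry H ?wt (eb i) (ew (p i))))"
  proof (rule sum.mono_neutral_right)
    show "finite {p. p permutes {0..<n}}" by (rule finite_permutations) simp
    show "edge_perms ?T n eb ew \<subseteq> {p. p permutes {0..<n}}" by (auto simp: edge_perms_def)
    show "\<forall>p\<in>{p. p permutes {0..<n}} - edge_perms ?T n eb ew.
        of_int (sign p) * (\<Prod>i=0..<n. entry H ?wt (eb i) (ew (p i))) = 0"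
    proof
      fix p assume "p \<in> {p. p permutes {0..<n}} - edge_perms ?T n eb ew"
      then obtain i where "i < n" "(eb i, ew (p i)) \<notin> edges ?T" by (auto simp: edge_perms_def)
      hence "(\<Prod>i=0..<n. entry H ?wt (eb i) (ew (p i))) = 0"
        by (intro prod_zero) (auto simp: entry_def intro!: bexI[of _ i])
      thus "of_int (sign p) * (\<Prod>i=0..<n. entry H ?wt (eb i) (ew (p i))) = 0" by simp
    qed
  qed
  also have "\<dots> = (\<Sum>p\<in>edge_perms ?T n eb ew. of_int \<kappa> * (\<Prod>i=0..<n. sign_weight wt \<sigma> (eb i, ew (p i))))"
  proof (rule sum.cong[OF refl])
    fix p assume p: "p \<in> edge_perms ?T n eb ew"
    hence "(\<Prod>i=0..<n. entry H ?wt (eb i) (ew (p i))) = (\<Prod>i=0..<n. compound_weight ?wt (eb i, ew (p i)))"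
      by (intro prod.cong) (auto simp: entry_def edge_perms_def)
    thus "of_int (sign p) * (\<Prod>i=0..<n. entry H ?wt (eb i) (ew (p i))) =
        of_int \<kappa> * (\<Prod>i=0..<n. sign_weight wt \<sigma> (eb i, ew (p i)))"
      using eq[OF p] by simp
  qed
  also have "\<dots> = of_int \<kappa> * sign_weighted_sum H wt \<sigma>"
    unfolding sign_weighted_sum_def matching_sum_eq_perm_sum[OF bipartite_total_graph[OF H] eb ew]
    by (simp add: sum_distrib_left)
  finally show ?thesis using \<kappa> by blast
qed

section \<open>The linear relation in a family\<close>

definition colour_sign :: "'s bgraph \<Rightarrow> 's \<Rightarrow> int" where
  "colour_sign S s = (if s \<in> blacks S then 1 else -1)"

lemma total_edge_iff:
  "(Base s b, Base s' w) \<in> edges (total_graph H) \<longleftrightarrow> s' = s \<and> s \<in> verts (super H) \<and> (b, w) \<in> edges (base H)"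
  "(Base s b, Leaf l) \<in> edges (total_graph H) \<longleftrightarrow> l \<in> leaves H \<and> s = leaf_copy H l \<and> b = leaf_at H l"
  "(Stem t, Base s w) \<in> edges (total_graph H) \<longleftrightarrow>
     t \<in> stems H \<and> w = stem_at H t \<and> (s = fst (stem_edge H t) \<or> s = snd (stem_edge H t))"
  "(Stem t, Leaf l) \<notin> edges (total_graph H)"
  by (auto simp: total_graph_def)

lemma total_vertex_iff:
  "Base s v \<in> blacks (total_graph H) \<longleftrightarrow> s \<in> verts (super H) \<and> v \<in> blacks (base H)"
  "Base s v \<in> whites (total_graph H) \<longleftrightarrow> s \<in> verts (super H) \<and> v \<in> whites (base H)"
  "Leaf l \<in> whites (total_graph H) \<longleftrightarrow> l \<in> leaves H"
  "Stem t \<in> blacks (total_graph H) \<longleftrightarrow> t \<in> stems H"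
  "Stem t \<notin> whites (total_graph H)"
  "Leaf l \<notin> blacks (total_graph H)"
  by (auto simp: total_graph_def)

text \<open>Every copy has as many black as white vertices, and there are as many stems as leaves.\<close>

lemma balanced_total_graph:
  assumes "compound_graph H"
  shows "card (blacks (total_graph H)) = card (whites (total_graph H))"
proof -
  have fin: "finite (verts (super H))" "finite (blacks (base H))" "finite (whites (base H))"
     "finite (stems H)" "finite (leaves H)"
    and c: "card (blacks (base H)) = card (whites (base H))" "card (leaves H) = card (stems H)"
    using assms by (auto simp: compound_graph_def bipartite_graph_def verts_def)
  have S: "{Base s v | s v. s \<in> verts (super H) \<and> v \<in> V} =
      (\<lambda>(s, v). Base s v) ` (verts (super H) \<times> V)" for V by auto
  have inj: "inj_on (\<lambda>(s, v). Base s v) A" for A by (auto simp: inj_on_def)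
  have "card (blacks (total_graph H)) = card (verts (super H)) * card (blacks (base H)) + card (stems H)"
    unfolding total_graph_def bgraph.simps S using fin
    by (subst card_Un_disjoint) (auto simp: card_image[OF inj] card_image inj_on_def card_cartesian_product)
  moreover have "card (whites (total_graph H)) = card (verts (super H)) * card (whites (base H)) + card (leaves H)"
    unfolding total_graph_def bgraph.simps S using fin
    by (subst card_Un_disjoint) (auto simp: card_image[OF inj] card_image inj_on_def card_cartesian_product)
  ultimately show ?thesis using c by simp
qed

text \<open>\<open>F\<close> is the matrix whose column \<open>Leaf p\<close> has been replaced by the signed sum of the columns that the
  family puts there.  A nonzero solution \<open>x\<close> of the base graph's system, with one more unknown
  \<open>None\<close> for the leaf, is repeated with sign \<open>c s\<close> in copy \<open>s\<close>.\<close>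

lemma alternating_leaf_column_kernel:
  fixes wt :: "'v \<times> 'v \<Rightarrow> 'r::idom" and H :: "('v, 's, 't, 'l) compound"
  assumes H: "compound_graph H" and p: "p \<in> leaves H"
  defines "c \<equiv> (\<lambda>s. of_int (colour_sign (super H) s) :: 'r)"
  assumes F: "\<And>x y. y \<noteq> Leaf p \<Longrightarrow> F x y = entry H wt x y"
    and Fp: "\<And>s b. s \<in> verts (super H) \<Longrightarrow> F (Base s b) (Leaf p) = (if b = leaf_at H p then c s else 0)"
    and Ft: "\<And>t. F (Stem t) (Leaf p) = 0"
  shows "\<exists>y. (\<exists>w\<in>whites (total_graph H). y w \<noteq> 0) \<and>
    (\<forall>b\<in>blacks (total_graph H). (\<Sum>w\<in>whites (total_graph H). F b w * y w) = 0)"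
proof -
  let ?G = "base H" and ?W = "whites (total_graph H)"
  \<comment> \<open>The base graph's matrix with the unit column of the vertex that carries the leaf appended.\<close>
  define f where "f = (\<lambda>b z. case z of Some w \<Rightarrow> (if (b, w) \<in> edges ?G then wt (b, w) else 0)
      | None \<Rightarrow> (if b = leaf_at H p then 1 else 0))"
  have fin: "finite (blacks ?G)" "finite (whites ?G)" "finite ?W"
    and cG: "card (blacks ?G) = card (whites ?G)"
    and EG: "edges ?G \<subseteq> blacks ?G \<times> whites ?G"
    and sE: "edges (super H) \<subseteq> blacks (super H) \<times> whites (super H)"
    and sd: "blacks (super H) \<inter> whites (super H) = {}"
    and st: "\<And>t. t \<in> stems H \<Longrightarrow> stem_edge H t \<in> edges (super H) \<and> stem_at H t \<in> whites ?G"
    and lf: "leaf_copy H p \<in> verts (super H)"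
    using H p bipartite_total_graph[OF H] by (auto simp: compound_graph_def bipartite_graph_def)
  have "card (blacks ?G) < card (insert None (Some ` whites ?G))"
    using fin cG by (simp add: card_image)
  then obtain x where x0: "\<exists>z\<in>insert None (Some ` whites ?G). x z \<noteq> 0"
    and x: "\<forall>b\<in>blacks ?G. (\<Sum>z\<in>insert None (Some ` whites ?G). f b z * x z) = 0"
    using underdetermined_system[of "blacks ?G" "insert None (Some ` whites ?G)" f] fin by auto
  have x': "(\<Sum>w\<in>whites ?G. f b (Some w) * x (Some w)) + f b None * x None = 0" if "b \<in> blacks ?G" for b
    using x that fin by (simp add: sum.reindex add.commute)
  define y :: "('v, 's, 't, 'l) cvertex \<Rightarrow> 'r" where
    "y = (\<lambda>v. case v of Base s w \<Rightarrow> c s * x (Some w) | Stem t \<Rightarrow> 0 | Leaf l \<Rightarrow> if l = p then x None else 0)"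
  have c0: "c s \<noteq> 0" for s by (simp add: c_def colour_sign_def)
  have "\<exists>w\<in>?W. y w \<noteq> 0"
  proof -
    obtain z where z: "z \<in> insert None (Some ` whites ?G)" "x z \<noteq> 0" using x0 by blast
    show ?thesis
    proof (cases z)
      case None
      thus ?thesis using z p by (intro bexI[of _ "Leaf p"]) (auto simp: y_def total_vertex_iff)
    next
      case (Some w)
      thus ?thesis using z lf c0
        by (intro bexI[of _ "Base (leaf_copy H p) w"]) (auto simp: y_def total_vertex_iff)
    qed
  qed
  moreover have "(\<Sum>w\<in>?W. F b w * y w) = 0" if b: "b \<in> blacks (total_graph H)" for b
  proof (cases b)
    case (Base s u)
    hence s: "s \<in> verts (super H)" and u: "u \<in> blacks ?G" using b by (auto simp: total_vertex_iff)
    let ?Z = "insert (Leaf p) (Base s ` whites ?G)"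
    have "(\<Sum>w\<in>?W. F b w * y w) = (\<Sum>w\<in>?Z. F b w * y w)"
    proof (rule sum.mono_neutral_right[OF fin(3)])
      show "?Z \<subseteq> ?W" using s p by (auto simp: total_vertex_iff)
      show "\<forall>w\<in>?W - ?Z. F b w * y w = 0"
      proof
        fix w assume w: "w \<in> ?W - ?Z"
        show "F b w * y w = 0"
        proof (cases w)
          case w': (Base s' w1)
          hence "(b, w) \<notin> edges (total_graph H)"
            using w Base by (auto simp: total_edge_iff total_vertex_iff)
          thus ?thesis using F[of w b] w' by (simp add: entry_def)
        qed (use w in \<open>auto simp: y_def\<close>)
      qed
    qed
    also have "\<dots> = F b (Leaf p) * y (Leaf p) + (\<Sum>w\<in>whites ?G. F b (Base s w) * y (Base s w))"
      using fin by (subst sum.insert) (auto simp: sum.reindex inj_on_def)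
    also have "\<dots> = c s * (f u None * x None + (\<Sum>w\<in>whites ?G. f u (Some w) * x (Some w)))"
      using F[of "Base s _" b] Fp[OF s, of u] Base s
      by (auto simp: y_def f_def entry_def total_edge_iff sum_distrib_left distrib_left intro!: sum.cong)
    also have "\<dots> = 0" using x'[OF u] by (simp add: add.commute)
    finally show ?thesis .
  next
    case (Stem t)
    hence t: "t \<in> stems H" using b by (simp add: total_vertex_iff)
    define s1 s2 a where "s1 = fst (stem_edge H t)" and "s2 = snd (stem_edge H t)" and "a = stem_at H t"
    have s12: "s1 \<in> blacks (super H)" "s2 \<in> whites (super H)" "a \<in> whites ?G"
      using st[OF t] sE by (auto simp: s1_def s2_def a_def)
    hence s12': "s1 \<noteq> s2" "s2 \<notin> blacks (super H)" using sd by auto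
    let ?Z = "{Base s1 a, Base s2 a}"
    have "(\<Sum>w\<in>?W. F b w * y w) = (\<Sum>w\<in>?Z. F b w * y w)"
    proof (rule sum.mono_neutral_right[OF fin(3)])
      show "?Z \<subseteq> ?W" using s12 by (auto simp: total_vertex_iff verts_def)
      show "\<forall>w\<in>?W - ?Z. F b w * y w = 0"
      proof
        fix w assume w: "w \<in> ?W - ?Z"
        show "F b w * y w = 0"
        proof (cases w)
          case w': (Base s' w1)
          hence "(b, w) \<notin> edges (total_graph H)"
            using w Stem by (auto simp: total_edge_iff s1_def s2_def a_def)
          thus ?thesis using F[of w b] w' by (simp add: entry_def)
        next
          case (Leaf l)
          thus ?thesis using Ft[of t] Stem by (auto simp: y_def)
        qed (use w in \<open>auto simp: y_def\<close>)
      qed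
    qed
    also have "\<dots> = F b (Base s1 a) * y (Base s1 a) + F b (Base s2 a) * y (Base s2 a)"
      using s12' by simp
    also have "F b (Base s1 a) = 1"
      using F[of "Base s1 a" b] Stem t by (simp add: entry_def total_edge_iff s1_def a_def)
    also have "F b (Base s2 a) = 1"
      using F[of "Base s2 a" b] Stem t by (simp add: entry_def total_edge_iff s2_def a_def)
    \<comment> \<open>The two copies joined by a stem have opposite colours.\<close>
    also have "1 * y (Base s1 a) + 1 * y (Base s2 a) = 0"
      using s12 s12' by (simp add: y_def c_def colour_sign_def)
    finally show ?thesis .
  qed (use b in \<open>simp add: total_vertex_iff\<close>)
  ultimately show ?thesis by blast
qed

theorem lemma4p1:
  fixes H :: "('v, 's, 't, 'l) compound"
    and p :: 'l
    and wt :: "'v \<times> 'v \<Rightarrow> 'r::idom"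
    and k :: nat
    and Hs :: "nat \<Rightarrow> ('v, 's, 't, 'l) compound"
    and \<sigma> :: "nat \<Rightarrow> ('v, 's, 't, 'l) cvertex \<times> ('v, 's, 't, 'l) cvertex \<Rightarrow> int"
  assumes "compound_graph H"
    and "p \<in> leaves H"
    and "\<And>i. i \<in> {1..k} \<Longrightarrow> Hs i \<in> family H p"
    and "bij_betw (\<lambda>i. leaf_copy (Hs i) p) {1..k} (verts (super H))"
    and "\<And>i. i \<in> {1..k} \<Longrightarrow> \<sigma> i \<in> sign_functions (Hs i)"
  shows "\<exists>\<epsilon> :: nat \<Rightarrow> int. (\<forall>i\<in>{2..k}. \<epsilon> i \<in> {1, -1}) \<and>
           sign_weighted_sum (Hs 1) wt (\<sigma> 1) +
             (\<Sum>i\<in>{2..k}. of_int (\<epsilon> i) * sign_weighted_sum (Hs i) wt (\<sigma> i)) = 0"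
proof -
  note H = assms(1)
  define S where "S = verts (super H)"
  define pos where "pos = (\<lambda>i. leaf_copy (Hs i) p)"
  have bij: "bij_betw pos {1..k} S" using assms(4) by (simp add: pos_def S_def)
  have s0: "leaf_copy H p \<in> S" using H assms(2) by (auto simp: compound_graph_def S_def)
  have k: "1 \<le> k"
  proof (rule ccontr)
    assume "\<not> 1 \<le> k"
    hence "S = {}" using bij by (simp add: bij_betw_def)
    thus False using s0 by simp
  qed
  have fam: "compound_graph (Hs i) \<and> (\<exists>D. Hs i = H\<lparr>leaf_copy := (leaf_copy H)(p := pos i), total_drawing := D\<rparr>)"
    if i: "i \<in> {1..k}" for i
    using assms(3)[OF i] by (auto simp: family_def pos_def)
  have same: "base (Hs i) = base H" "base_drawing (Hs i) = base_drawing H" "super (Hs i) = super H"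
      "blacks (total_graph (Hs i)) = blacks (total_graph H)"
      "whites (total_graph (Hs i)) = whites (total_graph H)"
    if i: "i \<in> {1..k}" for i
    using fam[OF i] by (auto simp: total_graph_def)
  \<comment> \<open>One sign function of the base graph, taken from the first member, serves for all determinants.\<close>
  define \<rho> where "\<rho> = (\<lambda>e. \<sigma> 1 (copy_edge (leaf_copy H p) e))"
  have \<rho>: "sign_function (base H) (base_drawing H) \<rho>"
  proof -
    have 1: "1 \<in> {1..k}" using k by simp
    have "sign_function (total_graph (Hs 1)) (total_drawing (Hs 1)) (\<sigma> 1)"
      using assms(5)[OF 1] by (simp add: sign_functions_def)
    moreover have "leaf_copy H p \<in> verts (super (Hs 1))" using s0 same(3)[OF 1] by (simp add: S_def)
    ultimately show ?thesis
      using sign_function_copy[of "Hs 1" "leaf_copy H p" "\<sigma> 1"] fam[OF 1] same(1,2)[OF 1]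
      by (simp add: \<rho>_def)
  qed
  let ?wt = "\<lambda>e. of_int (\<rho> e) * wt e"
  define n where "n = card (blacks (total_graph H))"
  have "finite (blacks (total_graph H))" "finite (whites (total_graph H))"
    using bipartite_total_graph[OF H] by (simp_all add: bipartite_graph_def)
  then obtain eb ew where eb: "bij_betw eb {0..<n} (blacks (total_graph H))"
    and ew: "bij_betw ew {0..<n} (whites (total_graph H))"
    using ex_bij_betw_nat_finite balanced_total_graph[OF H] unfolding n_def by metis
  define Det where "Det = (\<lambda>F. \<Sum>q | q permutes {0..<n}. of_int (sign q) *
       (\<Prod>i=0..<n. F (eb i) (ew (q i)) :: 'r))"
  have "\<exists>\<kappa>\<in>{1, -1 :: int}. Det (entry (Hs i) ?wt) = of_int \<kappa> * sign_weighted_sum (Hs i) wt (\<sigma> i)"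
    if i: "i \<in> {1..k}" for i
    unfolding Det_def
    using det_eq_sign_weighted_sum[of "Hs i" "leaf_copy H p" "\<sigma> i" \<rho> eb n ew wt]
      fam[OF i] assms(5)[OF i] same[OF i] s0 \<rho> eb ew by (simp add: S_def)
  then obtain \<kappa> where \<kappa>: "\<And>i. i \<in> {1..k} \<Longrightarrow> \<kappa> i \<in> {1, -1 :: int} \<and>
      Det (entry (Hs i) ?wt) = of_int (\<kappa> i) * sign_weighted_sum (Hs i) wt (\<sigma> i)" by metis
  define c where "c = colour_sign (super H)"
  have c: "c s \<in> {1, -1}" for s by (simp add: c_def colour_sign_def)
  \<comment> \<open>The determinants of the members differ only in the column of \<open>Leaf p\<close>, so their signed sum is the
    determinant with the signed sum of these columns.\<close>
  define F where "F = (\<lambda>x y. if y = Leaf p then \<Sum>i\<in>{1..k}. of_int (c (pos i)) * entry (Hs i) ?wt x y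
      else entry H ?wt x y)"
  have "(\<Sum>i\<in>{1..k}. of_int (c (pos i)) * Det (entry (Hs i) ?wt)) = Det F"
    unfolding Det_def
  proof (rule signed_permutation_sum_column[OF _ ew])
    show "Leaf p \<in> whites (total_graph H)" using assms(2) by (simp add: total_vertex_iff)
    show "entry (Hs i) ?wt b w = F b w" if "i \<in> {1..k}" "w \<noteq> Leaf p" for i b w
    proof -
      have "(b, w) \<in> edges (total_graph (Hs i)) \<longleftrightarrow> (b, w) \<in> edges (total_graph H)"
        using fam[OF that(1)] that(2) by (auto simp: total_graph_def)
      thus ?thesis using that(2) by (simp add: F_def entry_def)
    qed
  qed (simp_all add: F_def)
  also have "Det F = 0"
  proof -
    have leaf_at: "leaf_at (Hs i) = leaf_at H" "leaves (Hs i) = leaves H" if "i \<in> {1..k}" for i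
      using fam[OF that] by auto
    have FB: "F (Base s b) (Leaf p) = (if b = leaf_at H p then of_int (c s) else 0)" if s: "s \<in> S" for s b
    proof -
      have "F (Base s b) (Leaf p) =
          (\<Sum>i\<in>{1..k}. if pos i = s then (if b = leaf_at H p then of_int (c s) else 0) else 0)"
        unfolding F_def using leaf_at assms(2)
        by (auto simp: entry_def total_edge_iff pos_def intro!: sum.cong)
      also have "\<dots> = (\<Sum>s'\<in>S. if s' = s then (if b = leaf_at H p then of_int (c s) else 0) else 0)"
        by (rule sum.reindex_bij_betw[OF bij])
      also have "\<dots> = (if b = leaf_at H p then of_int (c s) else 0)"
      proof -
        have "finite S" using bij_betw_finite[OF bij] by simp
        thus ?thesis using s by simp
      qed
      finally show ?thesis .
    qed
    have "\<exists>y. (\<exists>w\<in>whites (total_graph H). y w \<noteq> 0) \<and>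
      (\<forall>b\<in>blacks (total_graph H). (\<Sum>w\<in>whites (total_graph H). F b w * y w) = 0)"
    proof (rule alternating_leaf_column_kernel[OF H assms(2), where wt = ?wt])
      show "F x y = entry H ?wt x y" if "y \<noteq> Leaf p" for x y using that by (simp add: F_def)
      show "F (Stem t) (Leaf p) = 0" for t by (simp add: F_def entry_def total_edge_iff)
      show "F (Base s b) (Leaf p) = (if b = leaf_at H p then of_int (colour_sign (super H) s) else 0)"
        if "s \<in> verts (super H)" for s b
        using FB[of s b] that by (simp add: S_def c_def)
    qed
    then obtain y where "\<exists>w\<in>whites (total_graph H). y w \<noteq> 0"
      "\<forall>b\<in>blacks (total_graph H). (\<Sum>w\<in>whites (total_graph H). F b w * y w) = 0" by blast
    thus ?thesis unfolding Det_def by (intro signed_permutation_sum_eq_0[OF eb ew]) auto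
  qed
  finally have total: "(\<Sum>i\<in>{1..k}. of_int (c (pos i)) * Det (entry (Hs i) ?wt)) = 0" .
  define \<delta> where "\<delta> = (\<lambda>i. c (pos i) * \<kappa> i)"
  have \<delta>: "\<delta> i \<in> {1, -1}" if "i \<in> {1..k}" for i
    using c[of "pos i"] \<kappa>[OF that] by (auto simp: \<delta>_def)
  let ?m = "\<lambda>i. sign_weighted_sum (Hs i) wt (\<sigma> i)"
  have "(\<Sum>i\<in>{1..k}. of_int (\<delta> i) * ?m i) = 0"
    unfolding total[symmetric] using \<kappa> by (intro sum.cong) (auto simp: \<delta>_def mult.assoc)
  hence "of_int (\<delta> 1) * (\<Sum>i\<in>{1..k}. of_int (\<delta> i) * ?m i) = 0" by simp
  hence "(\<Sum>i\<in>{1..k}. of_int (\<delta> 1 * \<delta> i) * ?m i) = 0" by (simp add: sum_distrib_left mult.assoc)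
  moreover have "{1..k} = insert 1 {2..k}" using k by auto
  ultimately have "of_int (\<delta> 1 * \<delta> 1) * ?m 1 + (\<Sum>i\<in>{2..k}. of_int (\<delta> 1 * \<delta> i) * ?m i) = 0"
    by simp
  moreover have \<delta>1: "\<delta> 1 \<in> {1, -1}" using \<delta>[of 1] k by simp
  moreover have "of_int (\<delta> 1 * \<delta> 1) = (1 :: 'r)" using \<delta>1 by auto
  moreover have "\<delta> 1 * \<delta> i \<in> {1, -1}" if "i \<in> {2..k}" for i
    using \<delta>[of i] \<delta>1 that by auto
  ultimately show ?thesis
    by (intro exI[of _ "\<lambda>i. \<delta> 1 * \<delta> i"] conjI ballI) (simp_all only: mult_1)
qed

end
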